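(* Let $F$ be a number field. Then $F_{\mathrm{pyth}}$ is hereditarily non-pythagorean and $F_{\mathrm{quad}}$ is hereditarily non-quadratically closed.
   Context: A number field is a finite extension of $\mathbb{Q}$. A field $K$ is pythagorean if every sum of squares of elements of $K$ is a square in $K$, and quadratically closed if every element of $K$ is a square in $K$. For a field $F$, inside a fixed algebraic closure of $F$, the pythagorean closure $F_{\mathrm{pyth}}$ is the direct limit (union) of all finite extensions of $F$ obtained by finite chains of quadratic extensions, each given by adjoining a square root of a sum of two squares of the preceding field; the quadratic closure $F_{\mathrm{quad}}$ is the direct limit (union) of all finite extensions of $F$ obtained by finite chains of quadratic extensions, each given by adjoining a square root of an arbitrary element of the preceding field. A field $k$ is hereditarily non-pythagorean (resp. hereditarily non-quadratically closed) if every proper finite extension $K/k$ that is not purely inseparable is not pythagorean (resp. not quadratically closed). *)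

theory Defs
  imports "HOL-Algebra.Algebra" "HOL-Algebra.Algebraic_Closure_Type"
begin

text \<open>
  A field extension \<open>K/k\<close> is a field homomorphism \<open>h\<close> from \<open>k\<close> to \<open>K\<close>, so that \<open>K\<close> is not
  required to live in the same type as \<open>k\<close>; \<open>k\<close> is identified with \<open>h ` carrier k\<close>.
\<close>

definition field_extension ::
    "('a, 'm) ring_scheme \<Rightarrow> ('b, 'n) ring_scheme \<Rightarrow> ('a \<Rightarrow> 'b) \<Rightarrow> bool" where
  "field_extension k K h \<longleftrightarrow> field k \<and> field K \<and> h \<in> ring_hom k K"

definition finite_field_extension ::
    "('a, 'm) ring_scheme \<Rightarrow> ('b, 'n) ring_scheme \<Rightarrow> ('a \<Rightarrow> 'b) \<Rightarrow> bool" where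
  "finite_field_extension k K h \<longleftrightarrow>
     field_extension k K h \<and> ring.finite_dimension K (h ` carrier k) (carrier K)"

definition proper_field_extension ::
    "('a, 'm) ring_scheme \<Rightarrow> ('b, 'n) ring_scheme \<Rightarrow> ('a \<Rightarrow> 'b) \<Rightarrow> bool" where
  "proper_field_extension k K h \<longleftrightarrow> field_extension k K h \<and> h ` carrier k \<noteq> carrier K"

text \<open>
  The order of \<open>\<one>\<close> in the additive group is the characteristic (with value \<open>0\<close> for infinite
  order); the characteristic exponent is \<open>1\<close> in characteristic \<open>0\<close> and \<open>p\<close> in characteristic \<open>p\<close>.
\<close>

definition char_exponent :: "('a, 'm) ring_scheme \<Rightarrow> nat" where
  "char_exponent k = max 1 (group.ord (add_monoid k) \<one>\<^bsub>k\<^esub>)"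

definition purely_inseparable_extension ::
    "('a, 'm) ring_scheme \<Rightarrow> ('b, 'n) ring_scheme \<Rightarrow> ('a \<Rightarrow> 'b) \<Rightarrow> bool" where
  "purely_inseparable_extension k K h \<longleftrightarrow>
     field_extension k K h \<and>
     (\<forall>x\<in>carrier K. \<exists>n. x [^]\<^bsub>K\<^esub> (char_exponent k ^ n) \<in> h ` carrier k)"

definition number_field :: "('a, 'm) ring_scheme \<Rightarrow> bool" where
  "number_field F \<longleftrightarrow> (\<exists>h. finite_field_extension (ring_of_type_algebra :: rat ring) F h)"

definition pythagorean :: "('a, 'm) ring_scheme \<Rightarrow> bool" where
  "pythagorean K \<longleftrightarrow> field K \<and>
     (\<forall>n. \<forall>f \<in> {..<n::nat} \<rightarrow> carrier K.
        \<exists>y\<in>carrier K. (\<Oplus>\<^bsub>K\<^esub>i\<in>{..<n}. f i [^]\<^bsub>K\<^esub> (2::nat)) = y [^]\<^bsub>K\<^esub> (2::nat))"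

definition quadratically_closed :: "('a, 'm) ring_scheme \<Rightarrow> bool" where
  "quadratically_closed K \<longleftrightarrow> field K \<and>
     (\<forall>a\<in>carrier K. \<exists>y\<in>carrier K. a = y [^]\<^bsub>K\<^esub> (2::nat))"

text \<open>
  Fields reachable from \<open>F\<close> by finite chains of quadratic extensions inside \<open>L\<close>. The condition
  \<open>x \<notin> E\<close> makes each step a proper extension, hence of degree \<open>2\<close>.
\<close>

inductive pyth_tower :: "('a, 'm) ring_scheme \<Rightarrow> 'a set \<Rightarrow> 'a set \<Rightarrow> bool"
  for L :: "('a, 'm) ring_scheme" and F :: "'a set" where
  base: "pyth_tower L F F"
| step: "\<lbrakk> pyth_tower L F E; a \<in> E; b \<in> E; x \<in> carrier L; x \<notin> E;
          x [^]\<^bsub>L\<^esub> (2::nat) = a [^]\<^bsub>L\<^esub> (2::nat) \<oplus>\<^bsub>L\<^esub> b [^]\<^bsub>L\<^esub> (2::nat) \<rbrakk>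
        \<Longrightarrow> pyth_tower L F (generate_field L (insert x E))"

inductive quad_tower :: "('a, 'm) ring_scheme \<Rightarrow> 'a set \<Rightarrow> 'a set \<Rightarrow> bool"
  for L :: "('a, 'm) ring_scheme" and F :: "'a set" where
  base: "quad_tower L F F"
| step: "\<lbrakk> quad_tower L F E; a \<in> E; x \<in> carrier L; x \<notin> E; x [^]\<^bsub>L\<^esub> (2::nat) = a \<rbrakk>
        \<Longrightarrow> quad_tower L F (generate_field L (insert x E))"

text \<open>The closures of \<open>F\<close> inside \<open>L\<close>, where \<open>L\<close> is meant to be an algebraic closure of \<open>F\<close>.\<close>

definition pythagorean_closure ::
    "('a, 'm) ring_scheme \<Rightarrow> 'a set \<Rightarrow> ('a, 'm) ring_scheme" where
  "pythagorean_closure L F = L \<lparr> carrier := \<Union> {E. pyth_tower L F E} \<rparr>"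

definition quadratic_closure ::
    "('a, 'm) ring_scheme \<Rightarrow> 'a set \<Rightarrow> ('a, 'm) ring_scheme" where
  "quadratic_closure L F = L \<lparr> carrier := \<Union> {E. quad_tower L F E} \<rparr>"

text \<open>
  HOL cannot quantify over types inside a formula, so the type \<open>'c\<close> of the elements of the
  extensions \<open>K\<close> is a parameter. In a theorem \<open>'c\<close> should be a type variable, which
  makes the statement hold for extensions in every type.
\<close>

definition hereditarily_non_pythagorean ::
    "'c itself \<Rightarrow> ('a, 'm) ring_scheme \<Rightarrow> bool" where
  "hereditarily_non_pythagorean (_ :: 'c itself) k \<longleftrightarrow> field k \<and>
     (\<forall>(K :: 'c ring) h.
        finite_field_extension k K h \<and> proper_field_extension k K h \<and>
        \<not> purely_inseparable_extension k K h \<longrightarrow> \<not> pythagorean K)"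

definition hereditarily_non_quadratically_closed ::
    "'c itself \<Rightarrow> ('a, 'm) ring_scheme \<Rightarrow> bool" where
  "hereditarily_non_quadratically_closed (_ :: 'c itself) k \<longleftrightarrow> field k \<and>
     (\<forall>(K :: 'c ring) h.
        finite_field_extension k K h \<and> proper_field_extension k K h \<and>
        \<not> purely_inseparable_extension k K h \<longrightarrow> \<not> quadratically_closed K)"

end

(* Let P be the closure, K a proper finite extension of P that is generated by a finite set Omega,
   and embed everything in the field of algebraic numbers. Every embedding that fixes F maps P to
   itself. Choose alpha in K outside P, an embedding sigma that fixes P and moves alpha, and a
   number field N containing generators of F, Omega, sigma(Omega), alpha, sigma(alpha) and i.
   Suppose that 1 + (alpha - t)^2 = y^2 with y in K for every integer t. An embedding tau that fixes
   N commutes with sigma on K and maps y to y or -y, so it fixes w = y sigma(y); hence w lies in N,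
   and w^2 = (1 + (alpha - t)^2) (1 + (sigma(alpha) - t)^2) is a quartic polynomial in t over N with
   a simple root r in N. This fails for a suitable t: by Hensel's lemma there is a prime p of degree
   one at which all roots are integral and r differs from the others modulo p, so t can be chosen
   such that t - r has valuation 1 and the other factors are units. Thus some 1 + x^2 has no square
   root in K, which is therefore neither pythagorean nor quadratically closed. *)
theory Submission
  imports Defs
begin

hide_const (open) UnivPoly.coeff UnivPoly.monom Polynomials.degree Polynomials.lead_coeff Divisibility.prime

section \<open>Integer polynomials and shifts that are not squares\<close>

text \<open>For each t the root y lies in K, but N has to be fixed before t is chosen and need not
  contain y. What an embedding over N can still change is a sign. As tau commutes with sigma on K,
  the same sign appears at sigma(y), and the product w is free of it; this is why a second factor is
  introduced. In return sigma has to move alpha: otherwise the quartic would be the square of 1 +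
  (alpha - t)^2, and the parity of valuations would give nothing. Two encodings shape the text.
  Rings of integers and completions are replaced by integer polynomials: for a generator theta of N
  one substitutes an integer that is a root, modulo a power of p, of an integer polynomial of least
  degree vanishing at theta, and equations become congruences. Galois groups are replaced by ring
  endomorphisms of the type of algebraic numbers.\<close>

definition ipoly :: "int poly \<Rightarrow> 'a::comm_ring_1 \<Rightarrow> 'a" where
  "ipoly p x = poly (map_poly of_int p) x"

lemma ipoly_0 [simp]: "ipoly 0 x = 0"
  by (simp add: ipoly_def)

lemma ipoly_pCons [simp]: "ipoly (pCons a p) x = of_int a + x * ipoly p x"
  by (simp add: ipoly_def map_poly_pCons)

lemma ipoly_1 [simp]: "ipoly 1 x = 1"
  by (simp add: one_pCons)

lemma ipoly_add [simp]: "ipoly (p + q) x = ipoly p x + ipoly q x"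
  by (induction p q rule: poly_induct2) (simp_all add: algebra_simps)

lemma ipoly_smult [simp]: "ipoly (Polynomial.smult c p) x = of_int c * ipoly p x"
  by (induction p) (simp_all add: algebra_simps)

lemma ipoly_minus [simp]: "ipoly (- p) x = - ipoly p x"
  using ipoly_smult[of "-1" p x] by simp

lemma ipoly_diff [simp]: "ipoly (p - q) x = ipoly p x - ipoly q x"
  using ipoly_add[of p "- q" x] by simp

lemma ipoly_mult [simp]: "ipoly (p * q) x = ipoly p x * ipoly q x"
  by (induction p) (simp_all add: algebra_simps)

lemma ipoly_power [simp]: "ipoly (p ^ n) x = ipoly p x ^ n"
  by (induction n) simp_all

lemma ipoly_pcompose [simp]: "ipoly (pcompose p q) x = ipoly p (ipoly q x)"
  by (induction p) (simp_all add: pcompose_pCons)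

lemma algebraic_imp_ipoly_root:
  fixes x :: "'a::field_char_0"
  assumes "algebraic x"
  obtains p where "p \<noteq> 0" "ipoly p x = 0"
  using assms by (elim algebraicE') (auto simp: ipoly_def)

lemma obtain_min_ipoly:
  fixes x :: "'a::field_char_0"
  assumes "algebraic x"
  obtains g where "g \<noteq> 0" "ipoly g x = 0"
    "\<And>h. h \<noteq> 0 \<Longrightarrow> ipoly h x = 0 \<Longrightarrow> degree g \<le> degree h"
proof -
  obtain p where "p \<noteq> 0 \<and> ipoly p x = 0"
    using assms algebraic_imp_ipoly_root by blast
  
  then show ?thesis
    using that ex_has_least_nat[of "\<lambda>p. p \<noteq> 0 \<and> ipoly p x = 0" p degree] by blast
qed

text \<open>Over the integers only pseudo-division by \<open>g\<close> is possible, hence the power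
  of the leading coefficient. The remainder vanishes at \<open>x\<close> and has too small a degree
  to be nonzero. The power does no harm modulo primes that do not divide
  \<open>lead_coeff g\<close>.\<close>

lemma min_ipoly_dvd:
  fixes x :: "'a::field_char_0"
  assumes "g \<noteq> 0" "ipoly g x = 0"
    and "\<And>h. h \<noteq> 0 \<Longrightarrow> ipoly h x = 0 \<Longrightarrow> degree g \<le> degree h"
    and "ipoly h x = 0"
  obtains n k where "Polynomial.smult (lead_coeff g ^ n) h = g * k"
proof -
  obtain q r where qr: "pseudo_divmod h g = (q, r)"
    by fastforce
  define n where "n = Suc (degree h) - degree g"
  have eq: "Polynomial.smult (lead_coeff g ^ n) h = g * q + r"
    and r: "r = 0 \<or> degree r < degree g"
    using pseudo_divmod[OF assms(1) qr] unfolding n_def by auto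
  have "ipoly (Polynomial.smult (lead_coeff g ^ n) h) x = ipoly (g * q + r) x"
    by (simp only: eq)
  then have "ipoly r x = 0"
    using assms(2,4) by simp
  then have "r = 0"
    using r assms(3)[of r] by fastforce
  then show ?thesis
    using that eq by simp
qed

text \<open>A substitute for the norm: a nonzero integer that is a multiple of \<open>x\<close> in
  Z[x]. It turns the nonvanishing of an algebraic number into a condition on primes.\<close>

lemma algebraic_ipoly_nonzero_const:
  fixes x :: "'a::field_char_0"
  assumes "algebraic x" "x \<noteq> 0"
  obtains c q where "c \<noteq> 0" "of_int c + x * ipoly q x = 0"
proof -
  obtain p where p: "p \<noteq> 0" "coeff p 0 \<noteq> 0" "poly (map_poly of_int p) x = 0"
    using algebraicE'_nonzero[OF assms] by blast
  obtain c q where "p = pCons c q"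
    by (cases p)
  then show ?thesis
    using that[of c q] p by (auto simp: ipoly_def map_poly_pCons)
qed

section \<open>Hensel lifting and primes modulo which a polynomial has a root\<close>

lemma poly_taylor2:
  fixes g :: "'a::idom poly"
  shows "\<exists>w. poly g (a + h) = poly g a + h * poly (pderiv g) a + h\<^sup>2 * w"
proof (induction g)
  case 0
  show ?case by (rule exI[of _ 0]) simp
next
  case (pCons c g)
  then obtain w where "poly g (a + h) = poly g a + h * poly (pderiv g) a + h\<^sup>2 * w"
    by blast
  then show ?case
    by (intro exI[of _ "a * w + poly (pderiv g) a + h * w"])
      (simp add: pderiv_pCons algebra_simps power2_eq_square)
qed

lemma poly_cong_mod:
  fixes g :: "int poly"
  assumes "m dvd a - b"
  shows "m dvd poly g a - poly g b"
proof (induction g)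
  case (pCons c g)
  have "poly (pCons c g) a - poly (pCons c g) b = (a - b) * poly g a + b * (poly g a - poly g b)"
    by (simp add: algebra_simps)
  then show ?case
    using assms pCons by (metis dvd_add dvd_mult dvd_mult2)
qed auto

lemma hensel_step:
  fixes g :: "int poly"
  assumes p: "prime p" and k: "k \<ge> 1"
    and root: "p ^ k dvd poly g a" and simple: "\<not> p dvd poly (pderiv g) a"
  shows "\<exists>b. p ^ k dvd b - a \<and> p ^ Suc k dvd poly g b"
proof -
  obtain u where u: "poly g a = p ^ k * u"
    using root by blast
  have "coprime (poly (pderiv g) a) p"
    using prime_imp_coprime[OF p simple] by (simp add: coprime_commute)
  then obtain v z where v: "v * poly (pderiv g) a + z * p = 1"
    using bezout_int[of "poly (pderiv g) a" p] by (auto simp: coprime_iff_gcd_eq_1)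
  define h where "h = p ^ k * (- u * v)"
  obtain w where w: "poly g (a + h) = poly g a + h * poly (pderiv g) a + h\<^sup>2 * w"
    using poly_taylor2 by blast
  have "poly g a + h * poly (pderiv g) a = p ^ k * u * (1 - poly (pderiv g) a * v)"
    by (simp add: u h_def algebra_simps)
  moreover have "1 - poly (pderiv g) a * v = z * p"
    using v by (simp add: algebra_simps)
  then have "p dvd 1 - poly (pderiv g) a * v"
    by simp
  ultimately have 1: "p ^ Suc k dvd poly g a + h * poly (pderiv g) a"
    by (metis dvd_mult2 mult.commute mult_dvd_mono dvd_refl power_Suc)
  have "p ^ Suc k dvd p ^ (2 * k)"
    using k by (intro le_imp_power_dvd) auto
  then have "p ^ Suc k dvd h\<^sup>2 * w"
    unfolding h_def by (simp add: power_mult_distrib power_mult mult.commute[of 2] dvd_mult2)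
  with 1 have "p ^ Suc k dvd poly g (a + h)"
    unfolding w by (rule dvd_add)
  then show ?thesis
    by (intro exI[of _ "a + h"]) (simp add: h_def)
qed

text \<open>\<open>b\<close> is a p-adic root cut off after \<open>Suc l\<close> digits, and the
  numbers \<open>c\<close> are other approximations of the same root. The two are separated because
  \<open>t\<close> is later built from \<open>b\<close> alone, while the required precision
  \<open>k\<close> depends on the denominator of a hypothetical square root
  \<open>w\<close>.\<close>

lemma hensel:
  fixes g :: "int poly"
  assumes p: "prime p" and "p dvd poly g a" and simple: "\<not> p dvd poly (pderiv g) a"
  obtains b where "p ^ Suc l dvd poly g b" "\<And>k. \<exists>c. p ^ Suc l dvd c - b \<and> p ^ k dvd poly g c"
proof -
  have lift: "\<exists>c. p ^ l dvd c - b \<and> p ^ k dvd poly g c"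
    if kl: "k \<ge> l" and l: "l \<ge> 1" and b: "p ^ l dvd poly g b" "\<not> p dvd poly (pderiv g) b" for k l b
    using kl
  proof (induction k rule: dec_induct)
    case base
    show ?case using b by (intro exI[of _ b]) auto
  next
    case (step k)
    then obtain c where c: "p ^ l dvd c - b" "p ^ k dvd poly g c"
      by blast
    have "p dvd c - b"
      using c(1) l by (meson dvd_power dvd_trans order_less_le_trans zero_less_one)
    then have "\<not> p dvd poly (pderiv g) c"
      using b(2) poly_cong_mod[of p c b "pderiv g"] by (metis dvd_add_right_iff diff_add_cancel)
    then obtain d where d: "p ^ k dvd d - c" "p ^ Suc k dvd poly g d"
      using hensel_step[OF p _ c(2)] l step by fastforce
    have "p ^ l dvd d - c"
      using d(1) step(1) by (meson dvd_trans le_imp_power_dvd)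
    then have "p ^ l dvd d - b"
      using c(1) by (metis dvd_add diff_add_cancel add_diff_eq diff_add_eq)
    then show ?case using d by blast
  qed
  obtain b where b: "p ^ 1 dvd b - a" "p ^ Suc l dvd poly g b"
    using lift[of 1 "Suc l" a] assms by auto
  then have "\<not> p dvd poly (pderiv g) b"
    using simple poly_cong_mod[of p b a "pderiv g"] by (metis power_one_right dvd_add_right_iff diff_add_cancel)
  then have "\<exists>c. p ^ Suc l dvd c - b \<and> p ^ k dvd poly g c" for k
  proof (cases "k \<ge> Suc l")
    case True
    then show ?thesis using lift[of "Suc l" k b] b \<open>\<not> p dvd poly (pderiv g) b\<close> by simp
  next
    case False
    then show ?thesis using b(2) by (intro exI[of _ b]) (metis diff_self dvd_0_right dvd_trans le_imp_power_dvd nat_le_linear)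
  qed
  then show ?thesis using that b by simp
qed

text \<open>Euclid's argument: if c is the constant term of \<open>g\<close>, the value of
  \<open>g\<close> at c \<delta> m is c times a number congruent to 1 modulo \<delta>, and no prime
  factor of that number divides \<delta>.\<close>

lemma prime_divides_value:
  fixes g :: "int poly"
  assumes "degree g > 0" "\<delta> \<noteq> 0"
  obtains p a where "prime p" "\<not> p dvd \<delta>" "p dvd poly g a"
proof (cases "poly g 0 = 0")
  case True
  obtain p :: nat where "prime p" "p > nat \<bar>\<delta>\<bar>"
    using bigger_prime by blast
  then have "prime (int p)" "\<not> int p dvd \<delta>"
    using assms(2) zdvd_imp_le[of "int p" "\<bar>\<delta>\<bar>"] by auto
  then show ?thesis using that True by (metis dvd_0_right)
next
  case False
  define c where "c = poly g 0"
  obtain g1 where g: "g = pCons c g1"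
    by (cases g) (simp add: c_def)
  have "g - [:c:] \<noteq> 0" "g + [:c:] \<noteq> 0"
    using assms(1) by (auto simp: g)
  then have "finite {x. poly (g - [:c:]) x = 0}" "finite {x. poly (g + [:c:]) x = 0}"
    using poly_roots_finite[of "g - [:c:]"] poly_roots_finite[of "g + [:c:]"] by blast+
  then have "finite ({x. poly (g - [:c:]) x = 0} \<union> {x. poly (g + [:c:]) x = 0})" (is "finite ?S")
    by blast
  \<comment> \<open>Some \<open>m\<close> avoids the finitely many points where \<open>g\<close>
    takes the values c and -c; there the cofactor \<open>u\<close> would be a unit, without prime
    factors.\<close>
  moreover have "infinite (range (\<lambda>m. c * \<delta> * m))"
    using False assms(2) by (subst finite_image_iff) (auto simp: inj_def c_def)
  ultimately have "\<not> range (\<lambda>m. c * \<delta> * m) \<subseteq> ?S"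
    using finite_subset by blast
  then obtain m where m: "c * \<delta> * m \<notin> ?S"
    by blast
  define u where "u = 1 + \<delta> * (m * poly g1 (c * \<delta> * m))"
  have val: "poly g (c * \<delta> * m) = c * u"
    by (simp add: g u_def algebra_simps)
  then have "\<bar>u\<bar> \<noteq> 1"
    using m by (auto simp: abs_if split: if_splits)
  then obtain p where p: "prime p" "p dvd u"
    using prime_factor_int by blast
  have "\<not> p dvd \<delta>"
  proof
    assume "p dvd \<delta>"
    then have "p dvd 1"
      using p(2) unfolding u_def by (metis dvd_add_left_iff dvd_mult2)
    then show False using p(1) by (simp add: not_prime_unit)
  qed
  moreover have "p dvd poly g (c * \<delta> * m)"
    using p(2) val by simp
  ultimately show ?thesis using that p(1) by blast
qed

section \<open>The field Q(theta) and products of shifts that are not squares in it\<close>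

definition Qadj :: "'a::field_char_0 \<Rightarrow> 'a set" where
  "Qadj \<theta> = {y. \<exists>p d. d \<noteq> 0 \<and> y = ipoly p \<theta> / of_int d}"

text \<open>This plays the part of a resultant of \<open>g\<close> and \<open>u\<close>: since
  \<open>u\<close> does not vanish at \<theta>, some nonzero integer is a combination of
  \<open>g\<close> and \<open>u\<close> in Z[X], and it is divisible by whatever divides both values
  at \<open>a\<close>.\<close>

lemma min_ipoly_coprime:
  fixes \<theta> :: "'a::field_char_0"
  assumes alg: "\<And>p. algebraic (ipoly p \<theta>)" and g: "g \<noteq> 0" "ipoly g \<theta> = 0"
    "\<And>h. h \<noteq> 0 \<Longrightarrow> ipoly h \<theta> = 0 \<Longrightarrow> degree g \<le> degree h"
    and u: "ipoly u \<theta> \<noteq> 0"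
  obtains \<delta> where "\<delta> \<noteq> 0" "\<And>p a. p dvd poly g a \<Longrightarrow> p dvd poly u a \<Longrightarrow> p dvd \<delta>"
proof -
  obtain c q where c: "c \<noteq> 0" "of_int c + ipoly u \<theta> * ipoly q (ipoly u \<theta>) = 0"
    using algebraic_ipoly_nonzero_const[OF alg u] by metis
  have "ipoly ([:c:] + u * pcompose q u) \<theta> = 0"
    using c by simp
  then obtain n k where k: "Polynomial.smult (lead_coeff g ^ n) ([:c:] + u * pcompose q u) = g * k"
    using min_ipoly_dvd[OF g] by blast
  have "p dvd lead_coeff g ^ n * c" if "p dvd poly g a" "p dvd poly u a" for p a
  proof -
    have "poly (Polynomial.smult (lead_coeff g ^ n) ([:c:] + u * pcompose q u)) a = poly (g * k) a"
      by (simp only: k)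
    then have "lead_coeff g ^ n * c = poly g a * poly k a
        - lead_coeff g ^ n * (poly u a * poly (pcompose q u) a)"
      by (simp add: algebra_simps)
    then show ?thesis
      using that by simp
  qed
  then show ?thesis
    using that[of "lead_coeff g ^ n * c"] c g by simp
qed

lemma common_denominator:
  assumes "finite I" "\<And>i. i \<in> I \<Longrightarrow> s i \<in> Qadj \<theta>"
  shows "\<exists>d S. d \<noteq> 0 \<and> (\<forall>i\<in>I. of_int d * s i = ipoly (S i) \<theta>)"
  using assms
proof (induction I)
  case empty
  show ?case by (intro exI[of _ 1]) simp
next
  case (insert x I)
  then obtain d S where d: "d \<noteq> 0" "\<forall>i\<in>I. of_int d * s i = ipoly (S i) \<theta>"
    by auto
  obtain p e where e: "e \<noteq> 0" "s x = ipoly p \<theta> / of_int e"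
    using insert.prems[of x] by (auto simp: Qadj_def)
  define S' where "S' i = (if i = x then Polynomial.smult d p else Polynomial.smult e (S i))" for i
  have "of_int (d * e) * s i = ipoly (S' i) \<theta>" if "i \<in> insert x I" for i
    using that insert.hyps d(2) e by (auto simp: S'_def mult_ac)
  then show ?case
    using d(1) e(1) by (intro exI[of _ "d * e"] exI[of _ S']) auto
qed

lemma ipoly_prod [simp]: "ipoly (\<Prod>i\<in>I. f i) x = (\<Prod>i\<in>I. ipoly (f i) x)"
  by (induction I rule: infinite_finite_induct) simp_all

text \<open>An equation between integer polynomials in \<theta> is a divisibility by
  \<open>g\<close>, up to powers of its leading coefficient. It therefore becomes a congruence at
  every integer \<open>c\<close> where \<open>g\<close> vanishes modulo a power of \<open>p\<close>,
  and valuations of integers decide the question.\<close>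

theorem exists_shift_nonsquare:
  fixes \<theta> r :: "'a::field_char_0" and s :: "'i \<Rightarrow> 'a"
  assumes alg: "\<And>x::'a. algebraic x" and "finite I"
    and r: "r \<in> Qadj \<theta>" and s: "\<And>i. i \<in> I \<Longrightarrow> s i \<in> Qadj \<theta>" "\<And>i. i \<in> I \<Longrightarrow> s i \<noteq> r"
  obtains t :: int where
    "\<And>w. w \<in> Qadj \<theta> \<Longrightarrow> w\<^sup>2 \<noteq> (of_int t - r) * (\<Prod>i\<in>I. of_int t - s i)"
proof -
  obtain d1 R1 where d1: "d1 \<noteq> 0" "r = ipoly R1 \<theta> / of_int d1"
    using r by (auto simp: Qadj_def)
  obtain d2 S2 where d2: "d2 \<noteq> 0" "\<And>i. i \<in> I \<Longrightarrow> of_int d2 * s i = ipoly (S2 i) \<theta>"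
    using common_denominator[OF \<open>finite I\<close>, of s \<theta>] s(1) by auto
  define d where "d = d1 * d2"
  define R where "R = Polynomial.smult d2 R1"
  define S where "S i = Polynomial.smult d1 (S2 i)" for i
  have d: "d \<noteq> 0" and R: "of_int d * r = ipoly R \<theta>"
    and S: "\<And>i. i \<in> I \<Longrightarrow> of_int d * s i = ipoly (S i) \<theta>"
    using d1 d2 by (simp_all add: d_def R_def S_def mult.assoc)
  obtain g where g: "g \<noteq> 0" "ipoly g \<theta> = 0"
    "\<And>h. h \<noteq> 0 \<Longrightarrow> ipoly h \<theta> = 0 \<Longrightarrow> degree g \<le> degree h"
    using obtain_min_ipoly[OF alg] by metis
  have deg: "degree g > 0"
    using g(1,2) by (cases g) (auto split: if_splits)
  have "pderiv g \<noteq> 0" "degree (pderiv g) < degree g"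
    using deg by (auto simp: pderiv_eq_0_iff degree_pderiv)
  then have "ipoly (pderiv g) \<theta> \<noteq> 0"
    using g(3) by fastforce
  then obtain \<delta>0 where \<delta>0: "\<delta>0 \<noteq> 0" "\<And>p a. p dvd poly g a \<Longrightarrow> p dvd poly (pderiv g) a \<Longrightarrow> p dvd \<delta>0"
    using min_ipoly_coprime[OF alg g] by metis
  have "\<exists>\<delta>. \<delta> \<noteq> 0 \<and> (\<forall>p a. p dvd poly g a \<longrightarrow> p dvd poly (R - S i) a \<longrightarrow> p dvd \<delta>)" if "i \<in> I" for i
  proof -
    have "ipoly (R - S i) \<theta> = of_int d * (r - s i)"
      using R S that by (simp add: algebra_simps)
    then have "ipoly (R - S i) \<theta> \<noteq> 0"
      using d s(2)[OF that] by auto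
    then show ?thesis
      using min_ipoly_coprime[OF alg g] by metis
  qed
  then obtain \<delta> where \<delta>: "\<And>i. i \<in> I \<Longrightarrow> \<delta> i \<noteq> 0"
    "\<And>i p a. i \<in> I \<Longrightarrow> p dvd poly g a \<Longrightarrow> p dvd poly (R - S i) a \<Longrightarrow> p dvd \<delta> i"
    by metis
  \<comment> \<open>A prime not dividing this product avoids all obstacles: the powers left by
    pseudo-division, the common denominator, multiple roots of \<open>g\<close> modulo
    \<open>p\<close>, and collisions of \<open>r\<close> with some \<open>s i\<close> modulo
    \<open>p\<close>.\<close>
  define \<Delta> where "\<Delta> = lead_coeff g * d * \<delta>0 * (\<Prod>i\<in>I. \<delta> i)"
  have "\<Delta> \<noteq> 0"
    using g(1) d \<delta>0(1) \<delta>(1) \<open>finite I\<close> by (simp add: \<Delta>_def)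
  then obtain p a where p: "prime p" "\<not> p dvd \<Delta>" "p dvd poly g a"
    using prime_divides_value[OF deg] by blast
  have good: "\<not> p dvd lead_coeff g" "\<not> p dvd d" "\<not> p dvd \<delta>0" "\<And>i. i \<in> I \<Longrightarrow> \<not> p dvd \<delta> i"
    using p(2) \<open>finite I\<close> unfolding \<Delta>_def by (auto dest: dvd_prodI dvd_trans)
  have "\<not> p dvd poly (pderiv g) a"
    using \<delta>0(2) p(3) good(3) by blast
  then obtain b where b: "p\<^sup>2 dvd poly g b" "\<And>k. \<exists>c. p\<^sup>2 dvd c - b \<and> p ^ k dvd poly g c"
    using hensel[OF p(1,3), of 1] unfolding Suc_1 by blast
  have "coprime d (p\<^sup>2)"
    using prime_imp_coprime[OF p(1) good(2)] by (simp add: coprime_commute)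
  then obtain v z where v: "v * d + z * p\<^sup>2 = 1"
    using bezout_int[of d "p\<^sup>2"] by (auto simp: coprime_iff_gcd_eq_1)
  \<comment> \<open>As \<open>v\<close> inverts \<open>d\<close> modulo the square of
    \<open>p\<close>, \<open>d * t\<close> is congruent to \<open>poly R b + p\<close> modulo that
    square. So its difference from \<open>poly R b\<close> is divisible by \<open>p\<close> exactly
    once.\<close>
  define t where "t = v * (poly R b + p)"
  have t: "d * t - poly R b = p - z * p\<^sup>2 * (poly R b + p)"
  proof -
    have "d * t = (v * d) * (poly R b + p)"
      by (simp add: t_def)
    also have "v * d = 1 - z * p\<^sup>2"
      using v by simp
    finally have "d * t = (1 - z * p\<^sup>2) * (poly R b + p)" .
    then show ?thesis by (simp add: algebra_simps)
  qed
  have simple: "p dvd d * t - poly R c \<and> \<not> p\<^sup>2 dvd d * t - poly R c" if cb: "p\<^sup>2 dvd c - b" for c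
  proof -
    obtain u where u: "poly R c - poly R b = p\<^sup>2 * u"
      using poly_cong_mod[OF cb, of R] by blast
    have eq: "d * t - poly R c = p * (1 - p * (z * (poly R b + p) + u))"
      using t u by (simp add: algebra_simps power2_eq_square)
    have "\<not> p dvd 1 - p * (z * (poly R b + p) + u)"
    proof
      assume "p dvd 1 - p * (z * (poly R b + p) + u)"
      then have "p dvd (1 - p * (z * (poly R b + p) + u)) + p * (z * (poly R b + p) + u)"
        by (rule dvd_add) simp
      then show False using p(1) by (simp add: not_prime_unit)
    qed
    then show ?thesis
      using p(1) unfolding eq power2_eq_square by auto
  qed
  have unit: "\<not> p dvd d * t - poly (S i) c" if "i \<in> I" "p\<^sup>2 dvd c - b" "p dvd poly g c" for i c
  proof
    assume "p dvd d * t - poly (S i) c"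
    then have "p dvd (d * t - poly (S i) c) - (d * t - poly R c)"
      using simple[OF that(2)] by (blast intro: dvd_diff)
    then have "p dvd poly (R - S i) c"
      by (simp add: algebra_simps)
    then show False
      using \<delta>(2) good(4) that by blast
  qed
  have "w\<^sup>2 \<noteq> (of_int t - r) * (\<Prod>i\<in>I. of_int t - s i)" if "w \<in> Qadj \<theta>" for w
  proof
    assume sq: "w\<^sup>2 = (of_int t - r) * (\<Prod>i\<in>I. of_int t - s i)"
    obtain W e where e: "e \<noteq> 0" "w = ipoly W \<theta> / of_int e"
      using \<open>w \<in> Qadj \<theta>\<close> by (auto simp: Qadj_def)
    \<comment> \<open>\<open>A\<close> and \<open>B\<close> represent the two sides of
      \<open>sq\<close> cleared of denominators: a factor \<open>d\<close> for each of the
      \<open>Suc (card I)\<close> linear terms, and the square of \<open>e\<close> for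
      \<open>w\<close>.\<close>
    define A where "A = Polynomial.smult (d ^ Suc (card I)) (W\<^sup>2)"
    define B where "B = Polynomial.smult (e\<^sup>2) (([:d * t:] - R) * (\<Prod>i\<in>I. [:d * t:] - S i))"
    have "ipoly ([:d * t:] - R) \<theta> = of_int d * (of_int t - r)"
      using R by (simp add: algebra_simps)
    moreover have "ipoly ([:d * t:] - S i) \<theta> = of_int d * (of_int t - s i)" if "i \<in> I" for i
      using S[OF that] by (simp add: algebra_simps)
    ultimately have "ipoly B \<theta> = of_int (e\<^sup>2) * (of_int d * (of_int t - r) * (\<Prod>i\<in>I. of_int d * (of_int t - s i)))"
      unfolding B_def by simp
    also have "\<dots> = of_int (e\<^sup>2) * (of_int d ^ Suc (card I) * w\<^sup>2)"
      by (simp add: sq prod.distrib mult_ac)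
    also have "\<dots> = ipoly A \<theta>"
      using e by (simp add: A_def power_divide)
    finally have "ipoly (A - B) \<theta> = 0"
      by simp
    then obtain n k where k: "Polynomial.smult (lead_coeff g ^ n) (A - B) = g * k"
      using min_ipoly_dvd[OF g] by blast
    \<comment> \<open>The square of \<open>e\<close> adds \<open>2 * j\<close> to the valuation of
      the value of \<open>B\<close>, and the one factor divisible by \<open>p\<close> adds 1. A
      congruence modulo \<open>p ^ (2 * j + 2)\<close> is just fine enough to pass this odd
      valuation on to \<open>A\<close>, where it must be even.\<close>
    define j where "j = multiplicity p e"
    obtain c where c: "p\<^sup>2 dvd c - b" "p ^ (2 * j + 2) dvd poly g c"
      using b(2) by blast
    have "p dvd poly g c"
      using c(2) by (meson dvd_power dvd_trans trans_less_add2 zero_less_numeral)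
    have "poly (Polynomial.smult (lead_coeff g ^ n) (A - B)) c = poly (g * k) c"
      by (simp only: k)
    then have "p ^ (2 * j + 2) dvd lead_coeff g ^ n * (poly A c - poly B c)"
      using c(2) by simp
    moreover have "coprime (p ^ (2 * j + 2)) (lead_coeff g ^ n)"
      using prime_imp_coprime[OF p(1) good(1)] by simp
    ultimately have diff: "p ^ (2 * j + 2) dvd poly A c - poly B c"
      using coprime_dvd_mult_right_iff by blast
    define y1 y2 where "y1 = d * t - poly R c" and "y2 = (\<Prod>i\<in>I. d * t - poly (S i) c)"
    have y1: "y1 \<noteq> 0" "multiplicity p y1 = 1"
      using simple[OF c(1)] multiplicity_eqI[of p 1 y1] by (auto simp: y1_def power2_eq_square)
    have "\<not> p dvd y2"
      using unit[OF _ c(1) \<open>p dvd poly g c\<close>] p(1) \<open>finite I\<close> by (auto simp: y2_def prime_dvd_prod_iff)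
    then have y2: "y2 \<noteq> 0" "multiplicity p y2 = 0"
      by (auto simp: not_dvd_imp_multiplicity_0)
    have "poly B c = e\<^sup>2 * (y1 * y2)"
      by (simp add: B_def y1_def y2_def poly_prod)
    then have B: "poly B c \<noteq> 0" "multiplicity p (poly B c) = 2 * j + 1"
      using y1 y2 e(1) p(1)
      by (auto simp: prime_elem_multiplicity_mult_distrib prime_elem_multiplicity_power_distrib j_def)
    have dvdY: "p ^ (2 * j + 1) dvd poly B c"
      using multiplicity_dvd[of p "poly B c"] by (simp only: B(2))
    have ndvdY: "\<not> p ^ (2 * j + 2) dvd poly B c"
      using B p(1) by (subst power_dvd_iff_le_multiplicity) (auto simp: not_prime_unit)
    have "p ^ (2 * j + 1) dvd poly A c - poly B c"
      using diff by (rule dvd_trans[rotated]) (auto intro: le_imp_power_dvd)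
    then have "p ^ (2 * j + 1) dvd poly A c"
      using dvdY dvd_add[of "p ^ (2 * j + 1)" "poly A c - poly B c" "poly B c"] by simp
    moreover have "\<not> p ^ Suc (2 * j + 1) dvd poly A c"
      using ndvdY diff dvd_diff[of "p ^ (2 * j + 2)" "poly A c" "poly A c - poly B c"] by auto
    ultimately have "multiplicity p (poly A c) = 2 * j + 1" and "poly A c \<noteq> 0"
      by (auto intro: multiplicity_eqI)
    moreover have "poly A c = d ^ Suc (card I) * (poly W c)\<^sup>2"
      by (simp add: A_def)
    ultimately have "2 * multiplicity p (poly W c) = 2 * j + 1"
      using p(1) d good(2)
      by (auto simp: prime_elem_multiplicity_mult_distrib prime_elem_multiplicity_power_distrib
          not_dvd_imp_multiplicity_0 simp del: power_Suc)
    then show False by presburger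
  qed
  then show ?thesis using that by blast
qed

section \<open>Extension of embeddings\<close>

text \<open>The counterpart of \<open>subfield\<close> for subsets of a type that is itself a field.
  The unrestricted clause for inverses is sound because \<open>inverse 0 = 0\<close>.\<close>

definition is_subfield :: "'a::field set \<Rightarrow> bool" where
  "is_subfield A \<longleftrightarrow> 1 \<in> A \<and> (\<forall>x\<in>A. \<forall>y\<in>A. x - y \<in> A \<and> x * y \<in> A) \<and> (\<forall>x\<in>A. inverse x \<in> A)"

lemma is_subfieldD:
  assumes "is_subfield A"
  shows "1 \<in> A" "0 \<in> A"
    and "x \<in> A \<Longrightarrow> y \<in> A \<Longrightarrow> x - y \<in> A" "x \<in> A \<Longrightarrow> y \<in> A \<Longrightarrow> x * y \<in> A"
    and "x \<in> A \<Longrightarrow> inverse x \<in> A" "x \<in> A \<Longrightarrow> - x \<in> A" "x \<in> A \<Longrightarrow> y \<in> A \<Longrightarrow> x + y \<in> A"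
    and "x \<in> A \<Longrightarrow> y \<in> A \<Longrightarrow> x / y \<in> A"
proof -
  show 1: "1 \<in> A"
    using assms by (simp add: is_subfield_def)
  show diff: "x - y \<in> A" if "x \<in> A" "y \<in> A" for x y
    using that assms by (simp add: is_subfield_def)
  show mult: "x * y \<in> A" if "x \<in> A" "y \<in> A" for x y
    using that assms by (simp add: is_subfield_def)
  show inv: "inverse x \<in> A" if "x \<in> A" for x
    using that assms by (simp add: is_subfield_def)
  show 0: "0 \<in> A" using diff[OF 1 1] by simp
  show minus: "- x \<in> A" if "x \<in> A" for x using diff[OF 0 that] by simp
  show "x + y \<in> A" if "x \<in> A" "y \<in> A" for x y
    using diff[OF that(1) minus[OF that(2)]] by simp
  show "x / y \<in> A" if "x \<in> A" "y \<in> A" for x y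
    using mult[OF that(1) inv[OF that(2)]] by (simp add: field_simps)
qed

lemma is_subfield_of_nat: "is_subfield A \<Longrightarrow> of_nat n \<in> A"
  by (induction n) (auto intro: is_subfieldD)

lemma is_subfield_of_int: "is_subfield A \<Longrightarrow> of_int n \<in> A"
  by (cases n rule: int_diff_cases) (auto intro: is_subfieldD is_subfield_of_nat)

section \<open>Polynomials over a subfield and their evaluation\<close>

definition poly_over :: "'a::zero set \<Rightarrow> 'a poly \<Rightarrow> bool" where
  "poly_over A p \<longleftrightarrow> (\<forall>i. coeff p i \<in> A)"

lemma poly_over_0 [simp]: "is_subfield A \<Longrightarrow> poly_over A 0"
  by (simp add: poly_over_def is_subfieldD)

lemma poly_over_pCons [simp]:
  "poly_over A (pCons a p) \<longleftrightarrow> a \<in> A \<and> poly_over A p"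
  unfolding poly_over_def by (metis coeff_pCons_0 coeff_pCons_Suc not0_implies_Suc)

lemma poly_over_1 [simp]: "is_subfield A \<Longrightarrow> poly_over A 1"
  by (simp add: one_pCons is_subfieldD)

lemma poly_over_diff: "is_subfield A \<Longrightarrow> poly_over A p \<Longrightarrow> poly_over A q \<Longrightarrow> poly_over A (p - q)"
  by (simp add: poly_over_def is_subfieldD)

lemma poly_over_add: "is_subfield A \<Longrightarrow> poly_over A p \<Longrightarrow> poly_over A q \<Longrightarrow> poly_over A (p + q)"
  by (simp add: poly_over_def is_subfieldD)

lemma poly_over_smult: "is_subfield A \<Longrightarrow> c \<in> A \<Longrightarrow> poly_over A p \<Longrightarrow> poly_over A (Polynomial.smult c p)"
  by (simp add: poly_over_def is_subfieldD)

lemma poly_over_mult: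
  assumes A: "is_subfield A" and q: "poly_over A q"
  shows "poly_over A p \<Longrightarrow> poly_over A (p * q)"
  by (induction p) (auto intro!: poly_over_add poly_over_smult A q is_subfieldD(2))

lemma poly_over_monom: "is_subfield A \<Longrightarrow> c \<in> A \<Longrightarrow> poly_over A (monom c n)"
  by (simp add: poly_over_def is_subfieldD)

lemma poly_over_pderiv: "is_subfield A \<Longrightarrow> poly_over A p \<Longrightarrow> poly_over A (pderiv p)"
  by (simp add: poly_over_def coeff_pderiv is_subfieldD(4) is_subfield_of_nat del: of_nat_Suc)

lemma poly_over_division:
  fixes p m :: "'a::field poly"
  assumes A: "is_subfield A" and m: "poly_over A m" "m \<noteq> 0" and p: "poly_over A p"
  shows "\<exists>q r. poly_over A q \<and> poly_over A r \<and> p = m * q + r \<and> (r = 0 \<or> degree r < degree m)"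
  using p
proof (induction "degree p" arbitrary: p rule: less_induct)
  case less
  show ?case
  proof (cases "p = 0 \<or> degree p < degree m")
    case True
    then show ?thesis using less.prems A by (intro exI[of _ 0] exI[of _ p]) auto
  next
    case False
    define s where "s = monom (lead_coeff p / lead_coeff m) (degree p - degree m)"
    have s: "poly_over A s"
      unfolding s_def using less.prems m(1)
      by (intro poly_over_monom A is_subfieldD(8)) (auto simp: poly_over_def)
    have deg: "degree (m * s) = degree p"
      using False m(2) by (auto simp: s_def degree_mult_eq degree_monom_eq)
    have lc: "lead_coeff (m * s) = lead_coeff p"
      using False m(2) by (simp only: lead_coeff_mult) (simp add: s_def degree_monom_eq)
    have over: "poly_over A (p - m * s)"
      by (intro poly_over_diff poly_over_mult A m less.prems s)
    show ?thesis
    proof (cases "degree p = 0")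
      \<comment> \<open>Both \<open>p\<close> and \<open>m\<close> are constant here: the degree
        cannot drop any further, but the difference vanishes.\<close>
      case True
      then have "p - m * s = 0"
        using deg lc by (metis degree_eq_zeroE coeff_pCons_0 degree_pCons_0 diff_self)
      then show ?thesis using s A by (intro exI[of _ s] exI[of _ 0]) auto
    next
      case False
      have "degree (p - m * s) < degree p"
        using False deg lc
        by (metis degree_diff_le dual_order.refl coeff_diff diff_self le_neq_implies_less leading_coeff_0_iff degree_0)
      from less.hyps[OF this over] obtain q r where "poly_over A q" "poly_over A r"
        "p - m * s = m * q + r" "r = 0 \<or> degree r < degree m" by blast
      then show ?thesis
        using s A by (intro exI[of _ "s + q"] exI[of _ r]) (auto simp: algebra_simps intro: poly_over_add)
    qed
  qed
qed

text \<open>Least degree gives a generator. The ideal is a predicate \<open>I\<close>, so that the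
  polynomials vanishing at a point of a ring record and those vanishing at a point of a type are
  both covered.\<close>

lemma poly_over_ideal_generator:
  assumes A: "is_subfield A" and p: "poly_over A p" "p \<noteq> 0" "I p"
    and diff: "\<And>p q. poly_over A p \<Longrightarrow> poly_over A q \<Longrightarrow> I p \<Longrightarrow> I q \<Longrightarrow> I (p - q)"
    and mult: "\<And>p q. poly_over A p \<Longrightarrow> poly_over A q \<Longrightarrow> I p \<Longrightarrow> I (p * q)"
  obtains m where "poly_over A m" "m \<noteq> 0" "I m"
    "\<And>p. poly_over A p \<Longrightarrow> I p \<Longrightarrow> \<exists>q. poly_over A q \<and> p = m * q"
proof -
  obtain m where m: "poly_over A m" "m \<noteq> 0" "I m"
    "\<And>q. poly_over A q \<Longrightarrow> q \<noteq> 0 \<Longrightarrow> I q \<Longrightarrow> degree m \<le> degree q"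
    using ex_has_least_nat[of "\<lambda>p. poly_over A p \<and> p \<noteq> 0 \<and> I p" p degree] p by blast
  have "\<exists>q. poly_over A q \<and> p = m * q" if p: "poly_over A p" "I p" for p
  proof -
    obtain q r where qr: "poly_over A q" "poly_over A r" "p = m * q + r" "r = 0 \<or> degree r < degree m"
      using poly_over_division[OF A m(1,2) p(1)] by blast
    have "I (p - m * q)"
      by (intro diff mult poly_over_mult A m qr p)
    then have "I r"
      using qr(3) by simp
    then have "r = 0"
      using m(4)[OF qr(2)] qr(4) by fastforce
    then show ?thesis using qr by auto
  qed
  then show ?thesis using that m by blast
qed

text \<open>Polynomials have their coefficients in the type \<open>'k\<close> and their values in
  the record \<open>R\<close>. This direction fits the extension of partial isomorphisms, where
  \<open>B\<close> is the range and \<open>\<psi>\<close> the inverse map, and where the type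
  supplies the roots.\<close>

locale coeff_embedding = field R for R (structure) +
  fixes B :: "'k::field set" and \<psi> :: "'k \<Rightarrow> 'a"
  assumes B: "is_subfield B"
    and emb_closed [simp]: "x \<in> B \<Longrightarrow> \<psi> x \<in> carrier R"
    and emb_one [simp]: "\<psi> 1 = \<one>"
    and emb_diff: "x \<in> B \<Longrightarrow> y \<in> B \<Longrightarrow> \<psi> (x - y) = \<psi> x \<ominus> \<psi> y"
    and emb_mult: "x \<in> B \<Longrightarrow> y \<in> B \<Longrightarrow> \<psi> (x * y) = \<psi> x \<otimes> \<psi> y"
begin

lemma emb_zero [simp]: "\<psi> 0 = \<zero>"
  using emb_diff[of 1 1] is_subfieldD(1)[OF B] by (simp add: minus_eq r_neg)

lemma emb_add: "x \<in> B \<Longrightarrow> y \<in> B \<Longrightarrow> \<psi> (x + y) = \<psi> x \<oplus> \<psi> y"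
  using emb_diff[of 0 y] emb_diff[of x "- y"] is_subfieldD(2,6)[OF B]
  by (simp add: minus_eq)

lemma emb_eq_zero_iff [simp]: "x \<in> B \<Longrightarrow> \<psi> x = \<zero> \<longleftrightarrow> x = 0"
  using emb_mult[of x "inverse x"] is_subfieldD(5)[OF B, of x] by (cases "x = 0") auto

definition ev :: "'a \<Rightarrow> 'k poly \<Rightarrow> 'a" where
  "ev z p = fold_coeffs (\<lambda>b acc. \<psi> b \<oplus> z \<otimes> acc) p \<zero>"

context
  fixes z assumes z [simp]: "z \<in> carrier R"
begin

lemma ev_0 [simp]: "ev z 0 = \<zero>"
  by (simp add: ev_def)

lemma ev_pCons [simp]: "ev z (pCons b p) = \<psi> b \<oplus> z \<otimes> ev z p"
proof (cases "p = 0")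
  case True
  then show ?thesis by (cases "b = 0") (simp_all add: ev_def)
qed (simp add: ev_def)

lemma ev_closed [simp]: "poly_over B p \<Longrightarrow> ev z p \<in> carrier R"
  by (induction p) simp_all

lemma ev_add: "poly_over B p \<Longrightarrow> poly_over B q \<Longrightarrow> ev z (p + q) = ev z p \<oplus> ev z q"
proof (induction p q rule: poly_induct2)
  case (pCons a p b q)
  then have "ev z p \<in> carrier R" "ev z q \<in> carrier R" "\<psi> a \<in> carrier R" "\<psi> b \<in> carrier R"
    by auto
  then show ?case using pCons by (simp add: emb_add r_distr a_ac)
qed simp

lemma ev_smult: "c \<in> B \<Longrightarrow> poly_over B p \<Longrightarrow> ev z (Polynomial.smult c p) = \<psi> c \<otimes> ev z p"
proof (induction p)
  case (pCons a p)
  then have "ev z p \<in> carrier R" "\<psi> a \<in> carrier R" "\<psi> c \<in> carrier R"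
    by auto
  then show ?case using pCons by (simp add: emb_mult r_distr m_ac)
qed simp

lemma ev_mult: "poly_over B p \<Longrightarrow> poly_over B q \<Longrightarrow> ev z (p * q) = ev z p \<otimes> ev z q"
proof (induction p)
  case (pCons a p)
  then have "ev z p \<in> carrier R" "ev z q \<in> carrier R" "\<psi> a \<in> carrier R"
    by auto
  moreover have "ev z (pCons a p * q) = \<psi> a \<otimes> ev z q \<oplus> z \<otimes> ev z (p * q)"
    using pCons by (simp add: ev_add ev_smult poly_over_smult poly_over_mult B is_subfieldD(2)[OF B])
  ultimately show ?case using pCons by (simp add: l_distr m_assoc)
qed simp

lemma ev_diff: "poly_over B p \<Longrightarrow> poly_over B q \<Longrightarrow> ev z (p - q) = ev z p \<ominus> ev z q"
proof -
  assume p: "poly_over B p" and q: "poly_over B q"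
  then have "ev z p = ev z (p - q) \<oplus> ev z q"
    by (simp add: ev_add[symmetric] poly_over_diff B)
  moreover have "ev z p \<in> carrier R" "ev z q \<in> carrier R" "ev z (p - q) \<in> carrier R"
    using p q by (auto simp: poly_over_diff B)
  ultimately show ?thesis by (simp add: minus_eq a_assoc r_neg)
qed

lemma ev_monom: "b \<in> B \<Longrightarrow> ev z (Polynomial.monom b n) = \<psi> b \<otimes> z [^] n"
proof (induction n)
  case (Suc n)
  have "\<psi> b \<in> carrier R" "z [^] n \<in> carrier R"
    using Suc by auto
  then show ?case using Suc by (simp add: monom_Suc m_ac)
qed (simp add: monom_0)

lemma ev_eq_zero_ideal_generator:
  assumes "poly_over B p" "p \<noteq> 0" "ev z p = \<zero>"
  obtains m where "poly_over B m" "m \<noteq> 0" "ev z m = \<zero>"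
    "\<And>p. poly_over B p \<Longrightarrow> ev z p = \<zero> \<Longrightarrow> \<exists>q. poly_over B q \<and> p = m * q"
proof (rule poly_over_ideal_generator[of B p "\<lambda>p. ev z p = \<zero>"])
  show "ev z (p - q) = \<zero>" if "poly_over B p" "poly_over B q" "ev z p = \<zero>" "ev z q = \<zero>" for p q
    using that by (simp add: ev_diff minus_eq)
  show "ev z (p * q) = \<zero>" if "poly_over B p" "poly_over B q" "ev z p = \<zero>" for p q
    using that by (simp add: ev_mult)
qed (use assms that B in auto)

text \<open>Instead of the irreducibility of \<open>m\<close>, two generators are compared: the
  generator \<open>n\<close> of the polynomials vanishing at \<open>z'\<close> divides
  \<open>m\<close>. If the cofactor vanished at \<open>z\<close>, it would be a multiple of
  \<open>m\<close>, and \<open>n\<close> would be a unit although it has a root. So \<open>n\<close>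
  vanishes at \<open>z\<close>.\<close>

lemma root_of_generator_conjugate:
  assumes m: "poly_over B m" "m \<noteq> 0" "ev z m = \<zero>"
    "\<And>p. poly_over B p \<Longrightarrow> ev z p = \<zero> \<Longrightarrow> \<exists>q. poly_over B q \<and> p = m * q"
    and root: "poly m z' = 0" and p: "poly_over B p"
  shows "ev z p = \<zero> \<longleftrightarrow> poly p z' = 0"
proof
  assume "ev z p = \<zero>"
  then show "poly p z' = 0" using m(4)[OF p] root by auto
next
  assume p0: "poly p z' = 0"
  obtain n where n: "poly_over B n" "n \<noteq> 0" "poly n z' = 0"
    "\<And>p. poly_over B p \<Longrightarrow> poly p z' = 0 \<Longrightarrow> \<exists>q. poly_over B q \<and> p = n * q"
    by (rule poly_over_ideal_generator[of B m "\<lambda>p. poly p z' = 0"]) (use B m root in auto)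
  obtain q where q: "poly_over B q" "m = n * q"
    using n(4) m(1) root by blast
  have "ev z n \<otimes> ev z q = \<zero>"
    using q m(3) n(1) by (simp add: ev_mult)
  then have "ev z n = \<zero> \<or> ev z q = \<zero>"
    using n(1) q(1) by (simp add: integral_iff)
  moreover have False if "ev z q = \<zero>"
  proof -
    obtain s where "q = m * s"
      using m(4)[OF q(1) \<open>ev z q = \<zero>\<close>] by blast
    then have "m * (n * s) = m * 1"
      using q(2) by (simp add: mult.left_commute)
    then have "n dvd 1"
      using m(2) by (metis dvdI mult_left_cancel)
    then show False
      using n(3) by (metis dvd_trans poly_1 zero_neq_one dvdE mult_zero_left poly_mult)
  qed
  ultimately have "ev z n = \<zero>"
    by blast
  then show "ev z p = \<zero>"
    using n(4)[OF p p0] n(1) by (auto simp: ev_mult)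
qed

end

end

section \<open>Partial isomorphisms and their maximal extensions\<close>

text \<open>The graph of an isomorphism between subrings of \<open>R\<close> and of \<open>'b\<close>; because \<open>G\<close> is closed
  under differences, the last clause says that \<open>G\<close> is single-valued and injective.\<close>

definition partial_iso :: "('a, 'm) ring_scheme \<Rightarrow> ('a \<times> 'b::field) set \<Rightarrow> bool" where
  "partial_iso R G \<longleftrightarrow> G \<subseteq> carrier R \<times> UNIV \<and> (\<one>\<^bsub>R\<^esub>, 1) \<in> G \<and>
     (\<forall>a b c d. (a, b) \<in> G \<longrightarrow> (c, d) \<in> G \<longrightarrow>
        (a \<ominus>\<^bsub>R\<^esub> c, b - d) \<in> G \<and> (a \<otimes>\<^bsub>R\<^esub> c, b * d) \<in> G) \<and>
     (\<forall>a b. (a, b) \<in> G \<longrightarrow> (a = \<zero>\<^bsub>R\<^esub> \<longleftrightarrow> b = 0))"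

context field
begin

lemma partial_isoD:
  assumes "partial_iso R G"
  shows "(a, b) \<in> G \<Longrightarrow> a \<in> carrier R" and "(\<one>, 1) \<in> G" and "(\<zero>, 0) \<in> G"
    and "(a, b) \<in> G \<Longrightarrow> (c, d) \<in> G \<Longrightarrow> (a \<ominus> c, b - d) \<in> G"
    and "(a, b) \<in> G \<Longrightarrow> (c, d) \<in> G \<Longrightarrow> (a \<otimes> c, b * d) \<in> G"
    and "(a, b) \<in> G \<Longrightarrow> a = \<zero> \<longleftrightarrow> b = 0"
    and "(a, b) \<in> G \<Longrightarrow> (c, d) \<in> G \<Longrightarrow> a = c \<longleftrightarrow> b = d"
proof -
  show one: "(\<one>, 1) \<in> G"
    using assms by (simp add: partial_iso_def)
  show carr: "a \<in> carrier R" if "(a, b) \<in> G" for a b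
    using that assms by (auto simp: partial_iso_def)
  show diff: "(a \<ominus> c, b - d) \<in> G" if "(a, b) \<in> G" "(c, d) \<in> G" for a b c d
    using that assms by (simp add: partial_iso_def)
  show "(a \<otimes> c, b * d) \<in> G" if "(a, b) \<in> G" "(c, d) \<in> G" for a b c d
    using that assms by (simp add: partial_iso_def)
  show zero: "a = \<zero> \<longleftrightarrow> b = 0" if "(a, b) \<in> G" for a b
    using that assms by (simp add: partial_iso_def)
  show "(\<zero>, 0) \<in> G"
    using diff[OF one one] by (simp add: minus_eq r_neg)
  show "a = c \<longleftrightarrow> b = d" if "(a, b) \<in> G" "(c, d) \<in> G" for a b c d
    using zero[OF diff[OF that]] carr[OF that(1)] carr[OF that(2)] by (simp add: r_right_minus_eq)
qed

lemma exists_maximal_partial_iso: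
  assumes "partial_iso R G\<^sub>0"
  obtains G where "partial_iso R G" "G\<^sub>0 \<subseteq> G" "\<And>G'. partial_iso R G' \<Longrightarrow> G \<subseteq> G' \<Longrightarrow> G' = G"
proof -
  define \<A> where "\<A> = {G. partial_iso R G \<and> G\<^sub>0 \<subseteq> G}"
  have "\<Union>C \<in> \<A>" if C: "C \<noteq> {}" "subset.chain \<A> C" for C
  proof -
    have chain: "C \<subseteq> \<A>" "\<And>G G'. G \<in> C \<Longrightarrow> G' \<in> C \<Longrightarrow> G \<subseteq> G' \<or> G' \<subseteq> G"
      using C(2) by (simp_all add: subset_chain_def)
    have iso: "partial_iso R G" "G\<^sub>0 \<subseteq> G" if "G \<in> C" for G
      using chain(1) that by (auto simp: \<A>_def)
    have two: "\<exists>G\<in>C. x \<in> G \<and> y \<in> G" if xy: "x \<in> \<Union>C" "y \<in> \<Union>C" for x y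
    proof -
      obtain G1 G2 where G: "x \<in> G1" "G1 \<in> C" "y \<in> G2" "G2 \<in> C"
        using xy by blast
      then have "G1 \<subseteq> G2 \<or> G2 \<subseteq> G1"
        using chain(2) by blast
      then show ?thesis
        using G by blast
    qed
    have "partial_iso R (\<Union>C)"
      unfolding partial_iso_def
    proof (intro conjI allI impI)
      show "\<Union>C \<subseteq> carrier R \<times> UNIV"
        using partial_isoD(1)[OF iso(1)] by auto
      show "(\<one>, 1) \<in> \<Union>C"
        using C(1) partial_isoD(2)[OF iso(1)] by auto
      show "a = \<zero> \<longleftrightarrow> b = 0" if "(a, b) \<in> \<Union>C" for a b
        using that partial_isoD(6)[OF iso(1)] by auto
      fix a b c d
      assume "(a, b) \<in> \<Union>C" "(c, d) \<in> \<Union>C"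
      then obtain G where "G \<in> C" "(a, b) \<in> G" "(c, d) \<in> G"
        using two by blast
      then show "(a \<ominus> c, b - d) \<in> \<Union>C" "(a \<otimes> c, b * d) \<in> \<Union>C"
        using partial_isoD(4,5)[OF iso(1)] by blast+
    qed
    then show ?thesis
      using C(1) iso(2) by (auto simp: \<A>_def)
  qed
  moreover have "\<A> \<noteq> {}"
    using assms by (auto simp: \<A>_def)
  ultimately obtain G where G: "G \<in> \<A>" "\<forall>G'\<in>\<A>. G \<subseteq> G' \<longrightarrow> G' = G"
    using subset_Zorn_nonempty[of \<A>] by blast
  show ?thesis
    by (rule that[of G]) (use G in \<open>auto simp: \<A>_def\<close>)
qed

text \<open>\<open>G'\<close> is the graph induced on fractions: a pair belongs to it if a nonzero
  pair of \<open>G\<close>, taken as denominator, multiplies it into \<open>G\<close>. Maximality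
  identifies it with \<open>G\<close>.\<close>

lemma maximal_partial_iso_inverse:
  assumes G: "partial_iso R G" and max: "\<And>G'. partial_iso R G' \<Longrightarrow> G \<subseteq> G' \<Longrightarrow> G' = G"
    and ab: "(a, b) \<in> G" "a \<noteq> \<zero>"
  shows "(inv a, inverse b) \<in> G"
proof -
  note D = partial_isoD[OF G]
  define G' where "G' = {(x, y). x \<in> carrier R \<and>
    (\<exists>c d. (c, d) \<in> G \<and> c \<noteq> \<zero> \<and> (x \<otimes> c, y * d) \<in> G)}"
  have "partial_iso R G'"
    unfolding partial_iso_def
  proof (intro conjI allI impI)
    show "G' \<subseteq> carrier R \<times> UNIV"
      by (auto simp: G'_def)
    show "(\<one>, 1) \<in> G'"
      using D(2) by (auto simp: G'_def intro!: exI[of _ \<one>] exI[of _ 1])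
  next
    fix x y assume "(x, y) \<in> G'"
    then obtain c d where cd: "x \<in> carrier R" "(c, d) \<in> G" "c \<noteq> \<zero>" "(x \<otimes> c, y * d) \<in> G"
      by (auto simp: G'_def)
    then show "x = \<zero> \<longleftrightarrow> y = 0"
      using D(6)[OF cd(2)] D(6)[OF cd(4)] D(1)[OF cd(2)] by (simp add: integral_iff)
  next
    fix x y x' y' assume "(x, y) \<in> G'" "(x', y') \<in> G'"
    then obtain c d c' d' where
      cd: "x \<in> carrier R" "(c, d) \<in> G" "c \<noteq> \<zero>" "(x \<otimes> c, y * d) \<in> G" and
      cd': "x' \<in> carrier R" "(c', d') \<in> G" "c' \<noteq> \<zero>" "(x' \<otimes> c', y' * d') \<in> G"
      by (auto simp: G'_def)
    have carr: "c \<in> carrier R" "c' \<in> carrier R"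
      using cd cd' D(1) by auto
    have cc: "(c \<otimes> c', d * d') \<in> G" "c \<otimes> c' \<noteq> \<zero>"
      using D(5)[OF cd(2) cd'(2)] cd(3) cd'(3) carr by (auto simp: integral_iff)
    have "((x \<otimes> c) \<otimes> c' \<ominus> (x' \<otimes> c') \<otimes> c, (y * d) * d' - (y' * d') * d) \<in> G"
      by (intro D(4,5) cd cd')
    also have "(x \<otimes> c) \<otimes> c' \<ominus> (x' \<otimes> c') \<otimes> c = (x \<ominus> x') \<otimes> (c \<otimes> c')"
      using carr cd(1) cd'(1) by algebra
    also have "(y * d) * d' - (y' * d') * d = (y - y') * (d * d')"
      by (simp add: algebra_simps)
    finally show "(x \<ominus> x', y - y') \<in> G'"
      using cc cd(1) cd'(1) by (auto simp: G'_def)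
    have "((x \<otimes> c) \<otimes> (x' \<otimes> c'), (y * d) * (y' * d')) \<in> G"
      by (intro D(5) cd cd')
    also have "(x \<otimes> c) \<otimes> (x' \<otimes> c') = (x \<otimes> x') \<otimes> (c \<otimes> c')"
      using carr cd(1) cd'(1) by algebra
    also have "(y * d) * (y' * d') = (y * y') * (d * d')"
      by (simp add: algebra_simps)
    finally show "(x \<otimes> x', y * y') \<in> G'"
      using cc cd(1) cd'(1) by (auto simp: G'_def)
  qed
  moreover have "G \<subseteq> G'"
    using D(1,2) by (auto simp: G'_def intro!: exI[of _ \<one>] exI[of _ 1])
  ultimately have "G' = G"
    by (rule max)
  moreover have "(inv a, inverse b) \<in> G'"
    using ab D(1,6)[OF ab(1)] D(2) by (auto simp: G'_def field_Units intro!: exI[of _ a] exI[of _ b])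
  ultimately show ?thesis by simp
qed

end

context coeff_embedding
begin

text \<open>Because the same polynomials vanish at \<open>z\<close> and \<open>z'\<close>, sending
  p(z) to p(z') is single-valued and injective.\<close>

lemma partial_iso_evaluation:
  assumes z: "z \<in> carrier R"
    and conj: "\<And>p. poly_over B p \<Longrightarrow> ev z p = \<zero> \<longleftrightarrow> poly p z' = 0"
  obtains G where "partial_iso R G" "(z, z') \<in> G" "\<And>b. b \<in> B \<Longrightarrow> (\<psi> b, b) \<in> G"
proof -
  define G where "G = {(ev z p, poly p z') | p. poly_over B p}"
  have I: "(ev z p, poly p z') \<in> G" if "poly_over B p" for p
    using that by (auto simp: G_def)
  have "partial_iso R G"
    unfolding partial_iso_def
  proof (intro conjI allI impI)
    show "G \<subseteq> carrier R \<times> UNIV"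
      using z by (auto simp: G_def)
    show "(\<one>, 1) \<in> G"
      using I[of 1] z B by (simp add: one_pCons is_subfieldD)
    show "a = \<zero> \<longleftrightarrow> b = 0" if "(a, b) \<in> G" for a b
      using that conj by (auto simp: G_def)
    fix a b c d assume "(a, b) \<in> G" "(c, d) \<in> G"
    then obtain p q where "poly_over B p" "a = ev z p" "b = poly p z'"
      "poly_over B q" "c = ev z q" "d = poly q z'"
      by (auto simp: G_def)
    then show "(a \<ominus> c, b - d) \<in> G" "(a \<otimes> c, b * d) \<in> G"
      using I[of "p - q"] I[of "p * q"] z B by (simp_all add: ev_diff ev_mult poly_over_diff poly_over_mult)
  qed
  moreover have "(z, z') \<in> G"
    using I[of "[:0, 1:]"] z B by (simp add: is_subfieldD)
  moreover have "(\<psi> b, b) \<in> G" if "b \<in> B" for b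
    using I[of "[:b:]"] z that B by simp
  ultimately show ?thesis using that by blast
qed

end

lemma (in field) partial_iso_subfield:
  assumes G: "partial_iso R G" and inv: "\<And>a b. (a, b) \<in> G \<Longrightarrow> a \<noteq> \<zero> \<Longrightarrow> (inv a, inverse b) \<in> G"
  shows "subfield (fst ` G) R"
proof (rule subfieldI')
  note D = partial_isoD[OF G]
  have minus: "(\<ominus> a, - b) \<in> G" if "(a, b) \<in> G" for a b
    using D(4)[OF D(3) that] D(1)[OF that] by (simp add: minus_eq)
  show "subring (fst ` G) R"
  proof (rule subringI)
    show "fst ` G \<subseteq> carrier R" "\<one> \<in> fst ` G"
      using D(1,2) by force+
    show "\<ominus> h \<in> fst ` G" if "h \<in> fst ` G" for h
      using that minus by force
    show "h1 \<otimes> h2 \<in> fst ` G" if "h1 \<in> fst ` G" "h2 \<in> fst ` G" for h1 h2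
      using that D(5) by force
    show "h1 \<oplus> h2 \<in> fst ` G" if h: "h1 \<in> fst ` G" "h2 \<in> fst ` G" for h1 h2
    proof -
      obtain b1 b2 where b: "(h1, b1) \<in> G" "(h2, b2) \<in> G"
        using h by auto
      have "(h1 \<ominus> (\<ominus> h2), b1 - (- b2)) \<in> G"
        by (intro D(4) minus b)
      then show ?thesis
        using D(1)[OF b(2)] by (force simp: minus_eq)
    qed
  qed
  show "inv k \<in> fst ` G" if "k \<in> fst ` G - {\<zero>}" for k
    using that inv by force
qed

lemma (in field) partial_iso_coeff_embedding:
  assumes G: "partial_iso R G" and inv: "\<And>a b. (a, b) \<in> G \<Longrightarrow> a \<noteq> \<zero> \<Longrightarrow> (inv a, inverse b) \<in> G"
  obtains \<psi> where "coeff_embedding R (snd ` G) \<psi>" "\<And>a b. (a, b) \<in> G \<Longrightarrow> \<psi> b = a"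
proof -
  note D = partial_isoD[OF G]
  define \<psi> where "\<psi> b = (THE a. (a, b) \<in> G)" for b
  have \<psi>: "\<psi> b = a" if "(a, b) \<in> G" for a b
    unfolding \<psi>_def by (rule the_equality) (use that D(7) in auto)
  have "inverse b \<in> snd ` G" if ab: "(a, b) \<in> G" for a b
  proof (cases "a = \<zero>")
    case True
    then show ?thesis using D(6)[OF ab] D(3) by (auto intro: rev_image_eqI)
  next
    case False
    then show ?thesis using inv[OF ab] by (auto intro: rev_image_eqI)
  qed
  moreover have "(b - d \<in> snd ` G) \<and> b * d \<in> snd ` G" if "(a, b) \<in> G" "(c, d) \<in> G" for a b c d
    using D(4,5)[OF that] by (auto intro: rev_image_eqI)
  moreover have "1 \<in> snd ` G"
    using D(2) by (auto intro: rev_image_eqI)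
  ultimately have "is_subfield (snd ` G)"
    unfolding is_subfield_def by auto
  moreover have "\<psi> 1 = \<one>"
    using \<psi> D(2) by blast
  ultimately have "coeff_embedding R (snd ` G) \<psi>"
    by unfold_locales (auto simp: \<psi> D(1) intro!: \<psi> D(4,5))
  then show ?thesis using \<psi> that by blast
qed

lemma (in field) algebraic_obtains_poly:
  assumes "coeff_embedding R B \<psi>" and A: "subring A R" "A \<subseteq> \<psi> ` B"
    and z: "z \<in> carrier R" "(algebraic over A) z"
  shows "\<exists>p. poly_over B p \<and> p \<noteq> 0 \<and> coeff_embedding.ev R \<psi> z p = \<zero>"
proof -
  interpret coeff_embedding R B \<psi> by fact
  \<comment> \<open>The lists carry the leading coefficient first. The last two clauses follow it
    through the conversion, so that the resulting polynomial can be seen to be nonzero.\<close>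
  have conv: "\<exists>q. poly_over B q \<and> ev z q = eval p z \<and> (\<forall>i\<ge>length p. Polynomial.coeff q i = 0) \<and>
      (p \<noteq> [] \<longrightarrow> \<psi> (Polynomial.coeff q (length p - 1)) = hd p)" if "set p \<subseteq> A" for p
    using that
  proof (induction p)
    case Nil
    show ?case using z B by (intro exI[of _ 0]) auto
  next
    case (Cons a p)
    then obtain q where q: "poly_over B q" "ev z q = eval p z" "\<And>i. i \<ge> length p \<Longrightarrow> Polynomial.coeff q i = 0"
      by auto
    obtain b where b: "b \<in> B" "a = \<psi> b"
      using Cons.prems A(2) by auto
    show ?case
      using q b z B
      by (intro exI[of _ "Polynomial.monom b (length p) + q"])
        (auto simp: ev_add ev_monom poly_over_add poly_over_monom)
  qed
  obtain p where p: "p \<in> carrier (A[X])" "p \<noteq> []" "eval p z = \<zero>"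
    using algebraicE[OF A(1) z] by metis
  then have "set p \<subseteq> A" "hd p \<noteq> \<zero>"
    by (auto simp: univ_poly_def polynomial_def)
  then obtain q where q: "poly_over B q" "ev z q = eval p z" "\<psi> (Polynomial.coeff q (length p - 1)) = hd p"
    using conv p(2) by blast
  then have "q \<noteq> 0"
    using \<open>hd p \<noteq> \<zero>\<close> by auto
  then show ?thesis using q p(3) by auto
qed

text \<open>Steinitz' argument: the domain of a maximal partial isomorphism is a field, and an
  element algebraic over it can be sent to a root of its transported minimal polynomial. This serves
  both to extend conjugations and to embed \<open>K\<close>.\<close>

lemma (in field) exists_alg_closed_partial_iso:
  fixes G\<^sub>0 :: "('a \<times> 'k::alg_closed_field) set"
  assumes "partial_iso R G\<^sub>0"
  shows "\<exists>G. partial_iso R G \<and> G\<^sub>0 \<subseteq> G \<and> subfield (fst ` G) R \<and>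
    (\<forall>z\<in>carrier R. (algebraic over (fst ` G)) z \<longrightarrow> z \<in> fst ` G)"
proof -
  obtain G where G: "partial_iso R G" "G\<^sub>0 \<subseteq> G" and
    max: "\<And>G'. partial_iso R G' \<Longrightarrow> G \<subseteq> G' \<Longrightarrow> G' = G"
    using exists_maximal_partial_iso[OF assms] by metis
  have inv: "(inv a, inverse b) \<in> G" if "(a, b) \<in> G" "a \<noteq> \<zero>" for a b
    using maximal_partial_iso_inverse[OF G(1) max that] .
  have sub: "subfield (fst ` G) R"
    using partial_iso_subfield[OF G(1) inv] .
  obtain \<psi> where emb: "coeff_embedding R (snd ` G) \<psi>" and \<psi>: "\<And>a b. (a, b) \<in> G \<Longrightarrow> \<psi> b = a"
    using partial_iso_coeff_embedding[OF G(1) inv] by metis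
  interpret coeff_embedding R "snd ` G" \<psi> by fact
  have "z \<in> fst ` G" if z: "z \<in> carrier R" "(algebraic over (fst ` G)) z" for z
  proof -
    have "fst ` G \<subseteq> \<psi> ` snd ` G"
    proof
      fix a assume "a \<in> fst ` G"
      then obtain b where "(a, b) \<in> G" by auto
      then show "a \<in> \<psi> ` snd ` G"
        using \<psi>[of a b] by (intro rev_image_eqI[of b]) (auto intro: rev_image_eqI)
    qed
    then obtain p where p: "poly_over (snd ` G) p" "p \<noteq> 0" "ev z p = \<zero>"
      using algebraic_obtains_poly[OF emb subfieldE(1)[OF sub] _ z] by blast
    obtain m where m: "poly_over (snd ` G) m" "m \<noteq> 0" "ev z m = \<zero>"
      "\<And>p. poly_over (snd ` G) p \<Longrightarrow> ev z p = \<zero> \<Longrightarrow> \<exists>q. poly_over (snd ` G) q \<and> p = m * q"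
      by (rule ev_eq_zero_ideal_generator[OF z(1) p]) blast
    have "Polynomial.degree m > 0"
    proof (rule ccontr)
      assume "\<not> Polynomial.degree m > 0"
      then obtain c where "m = [:c:]"
        by (auto elim: degree_eq_zeroE)
      then show False using m(1-3) z(1) by simp
    qed
    then obtain z' where "poly m z' = 0"
      using alg_closed_imp_poly_has_root by blast
    then obtain G' where G': "partial_iso R G'" "(z, z') \<in> G'" "\<And>b. b \<in> snd ` G \<Longrightarrow> (\<psi> b, b) \<in> G'"
      using partial_iso_evaluation[OF z(1) root_of_generator_conjugate[OF z(1) m]] by metis
    have "(a, b) \<in> G'" if "(a, b) \<in> G" for a b
    proof -
      have "b \<in> snd ` G" using that by force
      then show ?thesis using G'(3) \<psi>[OF that] by blast
    qed
    then have "G' = G"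
      by (intro max[OF G'(1)]) auto
    then show ?thesis
      using G'(2) by (auto intro: rev_image_eqI)
  qed
  then show ?thesis using G sub by (intro exI[of _ G]) blast
qed

section \<open>Endomorphisms and the elements they move\<close>

definition ring_endo :: "('a::ring_1 \<Rightarrow> 'a) \<Rightarrow> bool" where
  "ring_endo \<tau> \<longleftrightarrow> \<tau> 1 = 1 \<and> (\<forall>x y. \<tau> (x - y) = \<tau> x - \<tau> y \<and> \<tau> (x * y) = \<tau> x * \<tau> y)"

lemma ring_endoD:
  assumes "ring_endo \<tau>"
  shows "\<tau> 1 = 1" "\<tau> 0 = 0" "\<tau> (x - y) = \<tau> x - \<tau> y" "\<tau> (x * y) = \<tau> x * \<tau> y"
    "\<tau> (- x) = - \<tau> x" "\<tau> (x + y) = \<tau> x + \<tau> y" "\<tau> (x ^ n) = \<tau> x ^ n"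
proof -
  show 1: "\<tau> 1 = 1" and diff: "\<tau> (x - y) = \<tau> x - \<tau> y" and mult: "\<tau> (x * y) = \<tau> x * \<tau> y" for x y
    using assms by (auto simp: ring_endo_def)
  show 0: "\<tau> 0 = 0" using diff[of 1 1] by simp
  show minus: "\<tau> (- x) = - \<tau> x" for x using diff[of 0 x] 0 by simp
  show "\<tau> (x + y) = \<tau> x + \<tau> y" using diff[of x "- y"] minus by simp
  show "\<tau> (x ^ n) = \<tau> x ^ n" by (induction n) (simp_all add: 1 mult)
qed

lemma ring_endo_of_int: "ring_endo \<tau> \<Longrightarrow> \<tau> (of_int n) = of_int n"
proof -
  assume \<tau>: "ring_endo \<tau>"
  have "\<tau> (of_nat k) = of_nat k" for k
    by (induction k) (simp_all add: ring_endoD[OF \<tau>])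
  then show ?thesis
    by (cases n rule: int_diff_cases) (simp add: ring_endoD[OF \<tau>])
qed

lemma ring_endo_inverse:
  fixes \<tau> :: "'a::field \<Rightarrow> 'a"
  assumes "ring_endo \<tau>"
  shows "\<tau> (inverse x) = inverse (\<tau> x)"
proof (cases "x = 0")
  case False
  then have "\<tau> x * \<tau> (inverse x) = 1"
    using ring_endoD[OF assms] by (metis right_inverse)
  then show ?thesis by (simp add: inverse_unique)
qed (simp add: ring_endoD[OF assms])

lemma coeff_embedding_id:
  assumes "is_subfield (B :: 'a::field set)"
  shows "coeff_embedding (ring_of_type_algebra :: 'a ring) B id"
    and "z \<in> carrier (ring_of_type_algebra :: 'a ring) \<Longrightarrow> coeff_embedding.ev (ring_of_type_algebra :: 'a ring) id z p = poly p z"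
proof -
  let ?R = "ring_of_type_algebra :: 'a ring"
  interpret field ?R by (rule field_from_type_algebra)
  have minus: "\<ominus>\<^bsub>?R\<^esub> x = - x" for x
    by (rule sym, rule sum_zero_eq_neg) (simp_all add: ring_of_type_algebra_def)
  show emb: "coeff_embedding ?R B id"
    using assms by unfold_locales (simp_all add: a_minus_def minus, simp_all add: ring_of_type_algebra_def)
  interpret coeff_embedding ?R B id by fact
  show "ev z p = poly p z" if "z \<in> carrier ?R"
  proof (induction p)
    case 0
    show ?case by (simp only: ev_0[OF that] poly_0) (simp add: ring_of_type_algebra_def)
  next
    case (pCons a p)
    have "x \<oplus>\<^bsub>?R\<^esub> y = x + y" "x \<otimes>\<^bsub>?R\<^esub> y = x * y" for x y
      by (simp_all add: ring_of_type_algebra_def)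
    then have "ev z (pCons a p) = a + z * ev z p"
      by (simp only: ev_pCons[OF that]) simp
    then show ?case unfolding pCons.IH poly_pCons .
  qed
qed

text \<open>Separability: the minimal polynomial of \<open>z\<close> over \<open>A\<close> is coprime to its derivative, so it
  has a root other than \<open>z\<close> as soon as \<open>z \<notin> A\<close>.\<close>

lemma exists_other_conjugate:
  fixes z :: "'a::{alg_closed_field, field_char_0}"
  assumes A: "is_subfield A" and z: "algebraic z" "z \<notin> A"
  obtains z' where "z' \<noteq> z" "\<And>p. poly_over A p \<Longrightarrow> poly p z = 0 \<longleftrightarrow> poly p z' = 0"
proof -
  let ?R = "ring_of_type_algebra :: 'a ring"
  have zc: "z \<in> carrier ?R" by (simp add: ring_of_type_algebra_def)
  interpret coeff_embedding ?R A id by (rule coeff_embedding_id[OF A])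
  note ev_eq = coeff_embedding_id(2)[OF A zc]
  have zero: "\<zero>\<^bsub>?R\<^esub> = 0" by (simp add: ring_of_type_algebra_def)
  obtain p where p: "p \<noteq> 0" "poly (map_poly of_int p) z = 0"
    using algebraicE'[OF z(1)] by blast
  have "poly_over A (map_poly of_int p)" "map_poly of_int p \<noteq> (0 :: 'a poly)"
    using p(1) by (auto simp: poly_over_def coeff_map_poly is_subfield_of_int[OF A] map_poly_eq_0_iff)
  then obtain m where m: "poly_over A m" "m \<noteq> 0" "poly m z = 0"
      "\<And>p. poly_over A p \<Longrightarrow> poly p z = 0 \<Longrightarrow> \<exists>q. poly_over A q \<and> p = m * q"
    using ev_eq_zero_ideal_generator[OF zc] p(2) unfolding ev_eq zero by metis
  obtain q where q: "m = [:- z, 1:] * q"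
    using m(3) by (auto simp: poly_eq_0_iff_dvd)
  have "q \<noteq> 0" using q m(2) by auto
  have deg_m: "degree m = Suc (degree q)"
    unfolding q using \<open>q \<noteq> 0\<close> by (subst degree_mult_eq) auto
  \<comment> \<open>With a constant \<open>q\<close> the polynomial \<open>m\<close> would be linear
    over \<open>A\<close>, and its root \<open>z\<close> would lie in \<open>A\<close>.\<close>
  have "degree q > 0"
  proof (rule ccontr)
    assume "\<not> degree q > 0"
    then obtain c where "q = [:c:]" by (auto elim: degree_eq_zeroE)
    then have "m = [:- z * c, c:]" "c \<noteq> 0" using q \<open>q \<noteq> 0\<close> by auto
    then have "- z * c \<in> A" "c \<in> A" using m(1) by auto
    then show False using is_subfieldD(6)[OF A is_subfieldD(8)[OF A]] z(2) \<open>c \<noteq> 0\<close> by fastforce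
  qed
  then obtain z' where z': "poly q z' = 0"
    using alg_closed_imp_poly_has_root by blast
  have "poly q z \<noteq> 0"
  proof
    assume "poly q z = 0"
    then have "poly (pderiv m) z = 0"
      by (simp add: q pderiv_mult pderiv_pCons del: mult_pCons_left)
    then obtain s where s: "pderiv m = m * s"
      using m(4) poly_over_pderiv[OF A m(1)] by blast
    have "pderiv m \<noteq> 0" "degree (pderiv m) < degree m"
      using deg_m by (auto simp: pderiv_eq_0_iff degree_pderiv)
    then show False
      using s m(2) by (metis degree_mult_right_le mult_zero_right not_less)
  qed
  then have "z' \<noteq> z" using z' by auto
  moreover have "poly m z' = 0" using z' q by simp
  then have "poly p z = 0 \<longleftrightarrow> poly p z' = 0" if "poly_over A p" for p
    using root_of_generator_conjugate[OF zc m(1,2) _ _ _ that, of z'] m(3,4) unfolding ev_eq zero by blast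
  ultimately show ?thesis using that by blast
qed

text \<open>Send \<open>z\<close> to another conjugate over \<open>A\<close> and extend as far as
  possible; the domain then contains every algebraic number. Consequently an element fixed by all
  endomorphisms over \<open>A\<close> lies in \<open>A\<close>, which is how membership in a number
  field is proved later.\<close>

lemma exists_moving_endo:
  fixes z :: "'a::{alg_closed_field, field_char_0}"
  assumes alg: "\<And>x::'a. algebraic x" and A: "is_subfield A" and z: "z \<notin> A"
  obtains \<tau> where "ring_endo \<tau>" "\<And>x. x \<in> A \<Longrightarrow> \<tau> x = x" "\<tau> z \<noteq> z"
proof -
  let ?R = "ring_of_type_algebra :: 'a ring"
  obtain z' where z': "z' \<noteq> z" "\<And>p. poly_over A p \<Longrightarrow> poly p z = 0 \<longleftrightarrow> poly p z' = 0"
    using exists_other_conjugate[OF A alg z] by blast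
  have carr: "x \<in> carrier ?R" for x by (simp add: ring_of_type_algebra_def)
  have ops: "x \<ominus>\<^bsub>?R\<^esub> y = x - y" "x \<otimes>\<^bsub>?R\<^esub> y = x * y" "\<one>\<^bsub>?R\<^esub> = 1" "\<zero>\<^bsub>?R\<^esub> = 0" for x y
  proof -
    interpret field ?R by (rule field_from_type_algebra)
    have "\<ominus>\<^bsub>?R\<^esub> y = - y"
      by (rule sym, rule sum_zero_eq_neg) (simp_all add: ring_of_type_algebra_def)
    then show "x \<ominus>\<^bsub>?R\<^esub> y = x - y" by (simp add: a_minus_def) (simp add: ring_of_type_algebra_def)
  qed (simp_all add: ring_of_type_algebra_def)
  interpret coeff_embedding ?R A id by (rule coeff_embedding_id[OF A])
  have conj: "ev z p = \<zero>\<^bsub>?R\<^esub> \<longleftrightarrow> poly p z' = 0" if "poly_over A p" for p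
    using z'(2)[OF that] unfolding coeff_embedding_id(2)[OF A carr] ops .
  obtain G\<^sub>0 where G0: "partial_iso ?R G\<^sub>0" "(z, z') \<in> G\<^sub>0" "\<And>b. b \<in> A \<Longrightarrow> (id b, b) \<in> G\<^sub>0"
    by (rule partial_iso_evaluation[OF carr conj]) blast+
  obtain G where G: "partial_iso ?R G" "G\<^sub>0 \<subseteq> G" "subfield (fst ` G) ?R"
    "\<forall>z\<in>carrier ?R. (algebraic over (fst ` G)) z \<longrightarrow> z \<in> fst ` G"
    using exists_alg_closed_partial_iso[OF G0(1)] by blast
  have one: "(1, 1) \<in> G"
    using partial_isoD(2)[OF G(1)] by (simp only: ops)
  have diff: "(a - c, b - d) \<in> G" and mult: "(a * c, b * d) \<in> G" if "(a, b) \<in> G" "(c, d) \<in> G" for a b c d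
    using partial_isoD(4,5)[OF G(1) that] by (simp_all only: ops)
  have inj: "a = c \<longleftrightarrow> b = d" if "(a, b) \<in> G" "(c, d) \<in> G" for a b c d
    using partial_isoD(7)[OF G(1) that] .
  have "x \<in> fst ` G" for x
  proof -
    obtain p where p: "p \<noteq> 0" "poly (map_poly of_int p) x = 0"
      using algebraicE'[OF alg] by blast
    define q :: "'a poly" where "q = map_poly of_int p"
    have q: "q \<noteq> 0" "poly q x = 0" "set (Polynomial.coeffs q) \<subseteq> A"
      using p is_subfield_of_int[OF A] is_subfieldD(2)[OF A]
      by (auto simp: q_def map_poly_eq_0_iff set_coeffs_map_poly)
    \<comment> \<open>\<open>eval\<close> reads the leading coefficient first, whereas
      \<open>coeffs\<close> starts with the constant term; hence the reversals.\<close>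
    have eval: "eval xs x = poly (Poly (rev xs)) x" for xs
    proof (induction xs)
      case (Cons a xs)
      have pow: "x [^]\<^bsub>?R\<^esub> n = x ^ n" for n :: nat
        by (induction n) (simp_all add: ops mult.commute)
      have "a \<oplus>\<^bsub>?R\<^esub> b = a + b" for a b :: 'a
        by (simp add: ring_of_type_algebra_def)
      then show ?case
        using Cons by (simp add: ops pow Poly_append poly_monom)
    qed (simp add: ops)
    have "(algebraic over (fst ` G)) x"
    proof (rule algebraicI)
      have "set (Polynomial.coeffs q) \<subseteq> fst ` G"
        using q(3) G0(3) G(2) by force
      then show "rev (Polynomial.coeffs q) \<in> carrier ((fst ` G) [X]\<^bsub>?R\<^esub>)"
        using q(1) by (auto simp: univ_poly_def polynomial_def hd_rev last_coeffs_eq_coeff_degree ops)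
      show "rev (Polynomial.coeffs q) \<noteq> []"
        using q(1) by simp
      show "eval (rev (Polynomial.coeffs q)) x = \<zero>\<^bsub>?R\<^esub>"
        using q(2) by (simp add: eval ops)
    qed
    then show ?thesis using G(4) carr by blast
  qed
  define \<tau> where "\<tau> x = (THE y. (x, y) \<in> G)" for x
  have \<tau>I: "\<tau> x = y" if "(x, y) \<in> G" for x y
    unfolding \<tau>_def by (rule the_equality) (use that inj in auto)
  have \<tau>: "(x, \<tau> x) \<in> G" for x
  proof -
    obtain y where "(x, y) \<in> G" using \<open>x \<in> fst ` G\<close> by auto
    then show ?thesis using \<tau>I by auto
  qed
  show ?thesis
  proof (rule that[of \<tau>])
    show "ring_endo \<tau>"
      unfolding ring_endo_def using one diff mult \<tau> by (auto intro!: \<tau>I)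
    show "\<tau> x = x" if "x \<in> A" for x
      using G0(3)[OF that] G(2) by (auto intro: \<tau>I)
    show "\<tau> z \<noteq> z"
      using \<tau>I[of z z'] G0(2) G(2) z'(1) by auto
  qed
qed

section \<open>Finite extensions of stable fields\<close>

lemma Qadj_is_subfield:
  fixes \<theta> :: "'a::field_char_0"
  assumes alg: "\<And>x::'a. algebraic x"
  shows "is_subfield (Qadj \<theta>)"
  unfolding is_subfield_def
proof (intro conjI ballI)
  have I: "ipoly p \<theta> / of_int d \<in> Qadj \<theta>" if "d \<noteq> 0" for p d
    using that by (auto simp: Qadj_def)
  show "1 \<in> Qadj \<theta>"
    using I[of 1 1] by simp
  fix x assume "x \<in> Qadj \<theta>"
  then obtain p d where p: "d \<noteq> 0" "x = ipoly p \<theta> / of_int d"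
    by (auto simp: Qadj_def)
  show "inverse x \<in> Qadj \<theta>"
  proof (cases "ipoly p \<theta> = 0")
    case True
    then show ?thesis using I[of 1 0] p by simp
  next
    case False
    \<comment> \<open>Solving c + x q(x) = 0 for the inverse of x leaves only the integer
      \<open>c\<close> as a denominator.\<close>
    then obtain c q where c: "c \<noteq> 0" "of_int c + ipoly p \<theta> * ipoly q (ipoly p \<theta>) = 0"
      using algebraic_ipoly_nonzero_const[OF alg] by metis
    then have "ipoly p \<theta> * ipoly q (ipoly p \<theta>) = - of_int c"
      by (simp add: add_eq_0_iff2)
    then have "ipoly p \<theta> * (- ipoly q (ipoly p \<theta>) / of_int c) = 1"
      using c(1) by simp
    then have "inverse (ipoly p \<theta>) = - ipoly q (ipoly p \<theta>) / of_int c"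
      by (rule inverse_unique)
    moreover have "inverse x = of_int d * inverse (ipoly p \<theta>)"
      using p by (simp add: divide_inverse mult.commute)
    ultimately have "inverse x = ipoly (Polynomial.smult d (- pcompose q p)) \<theta> / of_int c"
      by simp
    then show ?thesis
      using I[OF c(1), of "Polynomial.smult d (- pcompose q p)"] by metis
  qed
  fix y assume "y \<in> Qadj \<theta>"
  then obtain q e where q: "e \<noteq> 0" "y = ipoly q \<theta> / of_int e"
    by (auto simp: Qadj_def)
  have "x - y = ipoly (Polynomial.smult e p - Polynomial.smult d q) \<theta> / of_int (d * e)"
    using p(1) q(1) by (simp add: p(2) q(2) diff_frac_eq mult.commute)
  then show "x - y \<in> Qadj \<theta>"
    using I[of "d * e" "Polynomial.smult e p - Polynomial.smult d q"] p(1) q(1) by (metis mult_eq_0_iff)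
  have "x * y = ipoly (p * q) \<theta> / of_int (d * e)"
    using p q by simp
  then show "x * y \<in> Qadj \<theta>"
    using I[of "d * e" "p * q"] p(1) q(1) by simp
qed

lemma Qadj_self: "\<theta> \<in> Qadj \<theta>"
  unfolding Qadj_def by (rule CollectI, intro exI[of _ "[:0, 1:]"] exI[of _ 1]) simp

lemma Qadj_subset:
  assumes A: "is_subfield A" "\<theta> \<in> A"
  shows "Qadj \<theta> \<subseteq> A"
proof -
  have "ipoly p \<theta> \<in> A" for p
    by (induction p) (auto intro!: is_subfieldD[OF A(1)] is_subfield_of_int A)
  then show ?thesis
    by (auto simp: Qadj_def intro!: is_subfieldD[OF A(1)] is_subfield_of_int A)
qed

text \<open>The classical argument for \<open>\<theta> = a + c b\<close>: a conjugate of \<open>b\<close> over \<open>\<rat>(\<theta>)\<close> other than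
  \<open>b\<close> would make \<open>c\<close> one of finitely many quotients of differences of roots.\<close>

lemma primitive_element_two:
  fixes a b :: "'a::{alg_closed_field, field_char_0}"
  assumes alg: "\<And>x::'a. algebraic x"
  shows "\<exists>\<theta>. a \<in> Qadj \<theta> \<and> b \<in> Qadj \<theta>"
proof -
  obtain f where f: "f \<noteq> 0" "ipoly f a = 0"
    using algebraic_imp_ipoly_root[OF alg] by blast
  obtain g where g: "g \<noteq> 0" "ipoly g b = 0"
    using algebraic_imp_ipoly_root[OF alg] by blast
  have fin: "finite {x::'a. ipoly h x = 0}" if "h \<noteq> 0" for h
    using poly_roots_finite[of "map_poly of_int h :: 'a poly"] that
    by (simp add: ipoly_def map_poly_eq_0_iff)
  define S where "S = (\<lambda>(x, y). (x - a) / (b - y)) ` ({x. ipoly f x = 0} \<times> {y. ipoly g y = 0})"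
  have "finite S"
    unfolding S_def using fin f(1) g(1) by blast
  moreover have "infinite (range (of_nat :: nat \<Rightarrow> 'a))"
    by (rule range_inj_infinite) (simp add: inj_of_nat)
  ultimately obtain c :: nat where c: "of_nat c \<notin> S"
    by (metis finite_subset image_subsetI)
  define \<theta> where "\<theta> = a + of_nat c * b"
  have sub: "is_subfield (Qadj \<theta>)"
    by (rule Qadj_is_subfield[OF alg])
  have "b \<in> Qadj \<theta>"
  proof (rule ccontr)
    assume "b \<notin> Qadj \<theta>"
    then obtain b' where b': "b' \<noteq> b"
      "\<And>p. poly_over (Qadj \<theta>) p \<Longrightarrow> poly p b = 0 \<longleftrightarrow> poly p b' = 0"
      using exists_other_conjugate[OF sub alg] by metis
    have over: "poly_over (Qadj \<theta>) (map_poly of_int h)" for h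
      by (simp add: poly_over_def coeff_map_poly is_subfield_of_int[OF sub])
    have "ipoly g b' = 0"
      using b'(2)[OF over] g(2) by (simp add: ipoly_def)
    \<comment> \<open>\<open>l\<close> takes \<open>b\<close> to \<open>a\<close>, so
      \<open>b\<close> is a root of \<open>f\<close> composed with \<open>l\<close>, a polynomial
      over \<open>Qadj \<theta>\<close>. Then \<open>b'\<close> is one as well, and \<open>l\<close>
      takes it to a root of \<open>f\<close>.\<close>
    define l where "l = [:\<theta>, - of_nat c:]"
    have l: "poly_over (Qadj \<theta>) l"
      by (simp add: l_def Qadj_self is_subfieldD(6)[OF sub] is_subfield_of_nat[OF sub] sub)
    have "poly_over (Qadj \<theta>) (pcompose (map_poly of_int h) l)" for h
    proof (induction h)
      case (pCons x h)
      then show ?case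
        using l by (simp add: map_poly_pCons pcompose_pCons poly_over_add poly_over_mult sub
            is_subfield_of_int[OF sub])
    qed (simp add: sub)
    from b'(2)[OF this[of f]] have "ipoly f (\<theta> - of_nat c * b') = 0"
      using f(2) by (simp add: poly_pcompose ipoly_def l_def \<theta>_def mult.commute)
    moreover have "(\<theta> - of_nat c * b' - a) / (b - b') = of_nat c"
      using b'(1) by (simp add: \<theta>_def field_simps)
    ultimately have "of_nat c \<in> S"
      unfolding S_def using \<open>ipoly g b' = 0\<close>
      by (intro image_eqI[of _ _ "(\<theta> - of_nat c * b', b')"]) simp_all
    then show False using c by blast
  qed
  moreover have "\<theta> - of_nat c * b \<in> Qadj \<theta>"
    by (intro is_subfieldD(3,4)[OF sub] Qadj_self is_subfield_of_nat sub \<open>b \<in> Qadj \<theta>\<close>)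
  ultimately show ?thesis
    by (intro exI[of _ \<theta>]) (simp add: \<theta>_def)
qed

lemma primitive_element:
  fixes A :: "'a::{alg_closed_field, field_char_0} set"
  assumes alg: "\<And>x::'a. algebraic x" and "finite A"
  shows "\<exists>\<theta>. A \<subseteq> Qadj \<theta>"
  using assms(2)
proof (induction A)
  case (insert x A)
  then obtain \<theta> where \<theta>: "A \<subseteq> Qadj \<theta>" by blast
  obtain \<eta> where \<eta>: "x \<in> Qadj \<eta>" "\<theta> \<in> Qadj \<eta>"
    using primitive_element_two[OF alg] by blast
  then have "Qadj \<theta> \<subseteq> Qadj \<eta>"
    by (intro Qadj_subset Qadj_is_subfield alg)
  then show ?case using \<theta> \<eta> by blast
qed simp

text \<open>\<open>\<Phi>\<close> stands for generators of the number field and \<open>P\<close> for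
  its closure; \<open>stable\<close> expresses normality of \<open>P\<close> over the field
  generated by \<open>\<Phi>\<close>. \<open>gen\<close> says that \<open>P\<close> and
  \<open>\<Omega>\<close> generate \<open>K\<close>, in the form in which identities of maps on
  \<open>K\<close> are checked on generators.\<close>

theorem nonsquare_in_finite_extension_of_stable:
  fixes P K \<Phi> \<Omega> :: "'a::{alg_closed_field, field_char_0} set"
  assumes alg: "\<And>x::'a. algebraic x"
    and P: "is_subfield P" and K: "is_subfield K" "P \<subseteq> K" "K \<noteq> P"
    and fin: "finite \<Phi>" "finite \<Omega>"
    and stable: "\<And>\<tau>. ring_endo \<tau> \<Longrightarrow> (\<And>x. x \<in> \<Phi> \<Longrightarrow> \<tau> x = x) \<Longrightarrow> \<tau> ` P \<subseteq> P"
    and gen: "\<And>A. is_subfield A \<Longrightarrow> P \<union> \<Omega> \<subseteq> A \<Longrightarrow> K \<subseteq> A"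
  shows "\<exists>x\<in>K. \<forall>y\<in>K. y\<^sup>2 \<noteq> 1 + x\<^sup>2"
proof (rule ccontr)
  assume "\<not> ?thesis"
  then have sq: "\<exists>y\<in>K. y\<^sup>2 = 1 + x\<^sup>2" if "x \<in> K" for x
    using that by blast
  obtain \<alpha> where \<alpha>: "\<alpha> \<in> K" "\<alpha> \<notin> P"
    using K(2,3) by blast
  obtain \<sigma> where \<sigma>: "ring_endo \<sigma>" "\<And>x. x \<in> P \<Longrightarrow> \<sigma> x = x" "\<sigma> \<alpha> \<noteq> \<alpha>"
    using exists_moving_endo[OF alg P \<alpha>(2)] by metis
  obtain \<iota> :: 'a where \<iota>: "\<iota>\<^sup>2 = -1"
    using nth_root_exists[of 2 "-1"] by auto
  have "\<iota> \<noteq> 0" using \<iota> by auto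
  obtain \<theta> where \<theta>: "\<Phi> \<union> \<Omega> \<union> \<sigma> ` \<Omega> \<union> {\<alpha>, \<sigma> \<alpha>, \<iota>} \<subseteq> Qadj \<theta>"
    using primitive_element[OF alg, of "\<Phi> \<union> \<Omega> \<union> \<sigma> ` \<Omega> \<union> {\<alpha>, \<sigma> \<alpha>, \<iota>}"] fin by blast
  have N: "is_subfield (Qadj \<theta>)"
    by (rule Qadj_is_subfield[OF alg])
  have square: "\<exists>w\<in>Qadj \<theta>. w\<^sup>2 = (1 + (\<alpha> - of_int t)\<^sup>2) * (1 + (\<sigma> \<alpha> - of_int t)\<^sup>2)" for t :: int
  proof -
    have "\<alpha> - of_int t \<in> K"
      by (intro is_subfieldD(3)[OF K(1)] \<alpha> is_subfield_of_int K)
    then obtain y where y: "y \<in> K" "y\<^sup>2 = 1 + (\<alpha> - of_int t)\<^sup>2"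
      using sq by blast
    have fixed: "\<tau> (y * \<sigma> y) = y * \<sigma> y"
      if \<tau>: "ring_endo \<tau>" "\<And>x. x \<in> Qadj \<theta> \<Longrightarrow> \<tau> x = x" for \<tau>
    proof -
      have \<tau>P: "\<tau> x \<in> P" if "x \<in> P" for x
        using stable[OF \<tau>(1)] \<tau>(2) \<theta> that by blast
      \<comment> \<open>On \<open>P\<close> the map \<sigma> is the identity and \<tau> does not
        leave \<open>P\<close>, so both sides equal \<open>\<tau> x\<close>. On \<Omega> the map
        \<tau> fixes \<open>x\<close> as well as \<open>\<sigma> x\<close>.\<close>
      have "is_subfield {x. \<tau> (\<sigma> x) = \<sigma> (\<tau> x)}"
        using \<sigma>(1) \<tau>(1) by (simp add: is_subfield_def ring_endoD ring_endo_inverse)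
      moreover have "P \<union> \<Omega> \<subseteq> {x. \<tau> (\<sigma> x) = \<sigma> (\<tau> x)}"
      proof
        fix x assume "x \<in> P \<union> \<Omega>"
        then consider "x \<in> P" | "x \<in> Qadj \<theta>" "\<sigma> x \<in> Qadj \<theta>"
          using \<theta> by blast
        then show "x \<in> {x. \<tau> (\<sigma> x) = \<sigma> (\<tau> x)}"
          using \<tau>P \<sigma>(2) \<tau>(2) by cases auto
      qed
      ultimately have comm: "\<tau> (\<sigma> y) = \<sigma> (\<tau> y)"
        using gen y(1) by blast
      have "(\<tau> y)\<^sup>2 = \<tau> (1 + (\<alpha> - of_int t)\<^sup>2)"
        using y(2) by (metis ring_endoD(7)[OF \<tau>(1)])
      also have "\<dots> = y\<^sup>2"
        using \<tau>(2)[of \<alpha>] \<theta> y(2) by (simp add: ring_endoD[OF \<tau>(1)] ring_endo_of_int[OF \<tau>(1)])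
      finally have "\<tau> y = y \<or> \<tau> y = - y"
        by (simp add: power2_eq_iff)
      then show ?thesis
        using comm by (auto simp: ring_endoD[OF \<tau>(1)] ring_endoD[OF \<sigma>(1)])
    qed
    have "y * \<sigma> y \<in> Qadj \<theta>"
    proof (rule ccontr)
      assume "y * \<sigma> y \<notin> Qadj \<theta>"
      from exists_moving_endo[OF alg N this] show False
        using fixed by metis
    qed
    moreover have "(\<sigma> y)\<^sup>2 = 1 + (\<sigma> \<alpha> - of_int t)\<^sup>2"
    proof -
      have "(\<sigma> y)\<^sup>2 = \<sigma> (1 + (\<alpha> - of_int t)\<^sup>2)"
        using y(2) by (metis ring_endoD(7)[OF \<sigma>(1)])
      then show ?thesis
        by (simp add: ring_endoD[OF \<sigma>(1)] ring_endo_of_int[OF \<sigma>(1)])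
    qed
    ultimately show ?thesis
      using y(2) by (intro bexI[of _ "y * \<sigma> y"]) (simp_all add: power_mult_distrib)
  qed
  text \<open>One of the roots \<open>\<alpha> + \<iota>\<close> and \<open>\<alpha> - \<iota>\<close> of the quartic in \<open>t\<close> is simple, since both
    coincidences \<open>\<alpha> + \<iota> = \<sigma> \<alpha> - \<iota>\<close> and \<open>\<alpha> - \<iota> = \<sigma> \<alpha> + \<iota>\<close> would force \<open>4 \<iota> = 0\<close>.\<close>
  have factor: "(1 + (\<alpha> - x)\<^sup>2) * (1 + (\<sigma> \<alpha> - x)\<^sup>2) =
      (x - (\<alpha> + j)) * ((x - (\<alpha> - j)) * ((x - (\<sigma> \<alpha> + j)) * (x - (\<sigma> \<alpha> - j))))" if "j\<^sup>2 = -1" for x j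
  proof -
    have "(x - (\<alpha> + j)) * (x - (\<alpha> - j)) = (\<alpha> - x)\<^sup>2 - j\<^sup>2" for \<alpha>
      by (simp add: power2_eq_square algebra_simps)
    then have "(x - (\<alpha> + j)) * (x - (\<alpha> - j)) = 1 + (\<alpha> - x)\<^sup>2" for \<alpha>
      using that by simp
    then show ?thesis by (metis mult.assoc)
  qed
  obtain j where j: "j\<^sup>2 = -1" "j \<in> Qadj \<theta>" "\<sigma> \<alpha> - j \<noteq> \<alpha> + j" "j \<noteq> 0"
  proof (cases "\<sigma> \<alpha> - \<iota> = \<alpha> + \<iota>")
    case True
    have "\<sigma> \<alpha> - (- \<iota>) \<noteq> \<alpha> + (- \<iota>)"
    proof
      assume "\<sigma> \<alpha> - (- \<iota>) = \<alpha> + (- \<iota>)"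
      with True have "4 * \<iota> = 0" by (simp add: algebra_simps) algebra
      then show False using \<open>\<iota> \<noteq> 0\<close> by simp
    qed
    then show ?thesis
      using that[of "- \<iota>"] \<iota> \<theta> \<open>\<iota> \<noteq> 0\<close> is_subfieldD(6)[OF N] by simp
  next
    case False
    then show ?thesis using that[of \<iota>] \<iota> \<theta> \<open>\<iota> \<noteq> 0\<close> by simp
  qed
  \<comment> \<open>An indexed family, not a set: \<open>\<alpha> - j\<close> and
    \<open>\<sigma> \<alpha> + j\<close> may coincide and must then be counted twice.\<close>
  define s where "s = (!) [\<alpha> - j, \<sigma> \<alpha> + j, \<sigma> \<alpha> - j]"
  have I: "{..<3} = {0, 1, 2::nat}" by auto
  have in_N: "\<alpha> + j \<in> Qadj \<theta>" "\<alpha> - j \<in> Qadj \<theta>" "\<sigma> \<alpha> + j \<in> Qadj \<theta>" "\<sigma> \<alpha> - j \<in> Qadj \<theta>"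
    using \<theta> j(2) by (auto intro!: is_subfieldD(3,7)[OF N])
  have "\<alpha> - j \<noteq> \<alpha> + j"
  proof
    assume "\<alpha> - j = \<alpha> + j"
    then have "2 * j = 0" by (simp add: algebra_simps)
    then show False using j(4) by simp
  qed
  then have s: "s i \<in> Qadj \<theta>" "s i \<noteq> \<alpha> + j" if "i \<in> {..<3}" for i
    using that in_N j(3) \<sigma>(3) unfolding I s_def by auto
  obtain t :: int where
    t: "\<And>w. w \<in> Qadj \<theta> \<Longrightarrow> w\<^sup>2 \<noteq> (of_int t - (\<alpha> + j)) * (\<Prod>i<3. of_int t - s i)"
    by (rule exists_shift_nonsquare[OF alg finite_lessThan in_N(1) s]) blast+
  have "(\<Prod>i<3. of_int t - s i) = (of_int t - (\<alpha> - j)) * ((of_int t - (\<sigma> \<alpha> + j)) * (of_int t - (\<sigma> \<alpha> - j)))"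
    unfolding I s_def by (simp add: numeral_2_eq_2)
  then show False
    using square[of t] t unfolding factor[OF j(1)] by auto
qed

lemma to_ac_rat_eq_quotient:
  fixes r :: rat
  obtains a b :: int where "to_ac r = of_int a / of_int b"
proof -
  obtain a b where "quotient_of r = (a, b)" by fastforce
  then have "to_ac r = of_int a / of_int b"
    using quotient_of_div by fastforce
  then show ?thesis using that by blast
qed

lemma algebraic_rat_alg_closure: "algebraic (x :: rat alg_closure)"
proof -
  obtain p where p: "p \<noteq> 0" "poly (map_poly to_ac p) x = 0"
    using alg_closure_algebraic by blast
  have "to_ac r \<in> \<rat>" for r :: rat
    by (rule to_ac_rat_eq_quotient[of r]) simp
  then show ?thesis
    using p by (auto simp: algebraic_altdef coeff_map_poly map_poly_eq_0_iff intro!: exI[of _ "map_poly to_ac p"])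
qed

section \<open>Towers of square roots\<close>

lemma ring_hom_type_algebra_iff:
  "g \<in> ring_hom R (ring_of_type_algebra :: 'b::ring_1 ring) \<longleftrightarrow>
    (\<forall>x\<in>carrier R. \<forall>y\<in>carrier R. g (x \<otimes>\<^bsub>R\<^esub> y) = g x * g y \<and> g (x \<oplus>\<^bsub>R\<^esub> y) = g x + g y) \<and> g \<one>\<^bsub>R\<^esub> = 1"
  by (auto simp: ring_hom_def ring_of_type_algebra_def)

context field
begin

context
  fixes g :: "'a \<Rightarrow> 'k::field"
  assumes g: "g \<in> ring_hom R ring_of_type_algebra"
begin

lemma type_hom_add: "x \<in> carrier R \<Longrightarrow> y \<in> carrier R \<Longrightarrow> g (x \<oplus> y) = g x + g y"
  and type_hom_mult: "x \<in> carrier R \<Longrightarrow> y \<in> carrier R \<Longrightarrow> g (x \<otimes> y) = g x * g y"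
  and type_hom_one: "g \<one> = 1"
  using g by (auto simp: ring_hom_type_algebra_iff)

lemma type_hom_zero: "g \<zero> = 0"
proof -
  have "g \<zero> + g \<zero> = g \<zero> + 0"
    using type_hom_add[of \<zero> \<zero>] by simp
  then show ?thesis by (simp only: add_left_cancel)
qed

lemma type_hom_minus: "x \<in> carrier R \<Longrightarrow> g (\<ominus> x) = - g x"
  using type_hom_add[of x "\<ominus> x"] by (simp add: type_hom_zero r_neg add_eq_0_iff)

lemma type_hom_power2: "x \<in> carrier R \<Longrightarrow> g (x [^] (2::nat)) = (g x)\<^sup>2"
  by (simp add: numeral_2_eq_2 type_hom_mult type_hom_one)

lemma type_hom_inv: "x \<in> carrier R \<Longrightarrow> x \<noteq> \<zero> \<Longrightarrow> g (inv x) = inverse (g x)"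
  using type_hom_mult[of x "inv x"] by (simp add: field_Units type_hom_one inverse_unique)

lemma type_hom_image_subfield: "is_subfield (g ` carrier R)"
  unfolding is_subfield_def
proof (intro conjI ballI)
  show "1 \<in> g ` carrier R"
    using type_hom_one by (metis imageI one_closed)
  fix x assume "x \<in> g ` carrier R"
  then obtain a where a: "a \<in> carrier R" "x = g a" by blast
  show "inverse x \<in> g ` carrier R"
  proof (cases "a = \<zero>")
    case True
    then show ?thesis using a type_hom_zero by force
  next
    case False
    then show ?thesis using a type_hom_inv[of a] by (metis field_Units Diff_iff Units_inv_closed empty_iff imageI insert_iff)
  qed
  fix y assume "y \<in> g ` carrier R"
  then obtain b where b: "b \<in> carrier R" "y = g b" by blast
  show "x - y \<in> g ` carrier R"
    using a b type_hom_add[of a "\<ominus> b"] type_hom_minus[of b] by (intro rev_image_eqI[of "a \<oplus> \<ominus> b"]) auto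
  show "x * y \<in> g ` carrier R"
    using a b type_hom_mult[of a b] by (intro rev_image_eqI[of "a \<otimes> b"]) auto
qed

end

text \<open>A span arises from sums and products, so closure of \<open>S\<close> under these is
  enough. Later \<open>S\<close> is a set on which two maps agree, or the preimage of a
  subfield.\<close>

lemma finite_dimension_generators:
  assumes k: "subfield k R" and "finite_dimension k E"
  shows "\<exists>U. finite U \<and> U \<subseteq> carrier R \<and>
    (\<forall>S. k \<subseteq> S \<longrightarrow> U \<subseteq> S \<longrightarrow> (\<forall>x\<in>S. \<forall>y\<in>S. x \<oplus> y \<in> S \<and> x \<otimes> y \<in> S) \<longrightarrow> E \<subseteq> S)"
proof -
  obtain n where "dimension n k E"
    using assms(2) by (auto simp: finite_dimension_def)
  then obtain Vs where Vs: "set Vs \<subseteq> carrier R" "Span k Vs = E"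
    using exists_base[OF k] by metis
  have "Span k Us \<subseteq> S"
    if "k \<subseteq> S" "set Us \<subseteq> S" "\<forall>x\<in>S. \<forall>y\<in>S. x \<oplus> y \<in> S \<and> x \<otimes> y \<in> S" for S Us
    using that(2)
  proof (induction Us)
    case Nil
    then show ?case using that(1) subringE(2)[OF subfieldE(1)[OF k]] by auto
  next
    case (Cons u Us)
    then have "Span k Us \<subseteq> S" "u \<in> S" by auto
    show ?case
    proof
      fix x assume "x \<in> Span k (u # Us)"
      then obtain c v where "c \<in> k" "v \<in> Span k Us" "x = c \<otimes> u \<oplus> v"
        by (auto simp: line_extension_mem_iff)
      then show "x \<in> S"
        using that(1,3) \<open>Span k Us \<subseteq> S\<close> \<open>u \<in> S\<close> by blast
    qed
  qed
  then show ?thesis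
    using Vs by (intro exI[of _ "set Vs"]) auto
qed

end

section \<open>Towers with prescribed radicands and their union\<close>

lemma (in algebraically_closed) exists_sqrt:
  assumes u: "u \<in> carrier L"
  obtains z where "z \<in> carrier L" "z [^] (2::nat) = u"
proof -
  let ?p = "[\<one>, \<zero>, \<ominus> u]"
  have p: "?p \<in> carrier (poly_ring L)"
    using u by (simp add: univ_poly_def polynomial_def)
  then have "splitted ?p"
    by (rule roots_over_carrier)
  then have "roots ?p \<noteq> {#}"
    by (auto simp: splitted_def)
  then obtain z where "z \<in># roots ?p"
    by blast
  then have z: "z \<in> carrier L" "eval ?p z = \<zero>"
    using roots_mem_iff_is_root[OF p] by (auto simp: is_root_def)
  then have "z [^] (2::nat) \<oplus> (\<zero> \<oplus> \<ominus> u) = \<zero>"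
    using u by (simp add: numeral_2_eq_2)
  then have "z [^] (2::nat) = u"
    using u z(1) by (metis l_zero a_inv_closed minus_eq nat_pow_closed r_right_minus_eq)
  then show ?thesis using that z(1) by blast
qed

text \<open>\<open>rad E\<close> is the set of those elements whose square roots may be adjoined to \<open>E\<close>.\<close>

inductive rad_tower :: "('a, 'm) ring_scheme \<Rightarrow> ('a set \<Rightarrow> 'a set) \<Rightarrow> 'a set \<Rightarrow> 'a set \<Rightarrow> bool"
  for L :: "('a, 'm) ring_scheme" and rad :: "'a set \<Rightarrow> 'a set" and F :: "'a set" where
  base: "rad_tower L rad F F"
| step: "\<lbrakk> rad_tower L rad F E; x \<in> carrier L; x \<notin> E; x [^]\<^bsub>L\<^esub> (2::nat) \<in> rad E \<rbrakk>
        \<Longrightarrow> rad_tower L rad F (generate_field L (insert x E))"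

definition sums_of_two_squares :: "('a, 'm) ring_scheme \<Rightarrow> 'a set \<Rightarrow> 'a set" where
  "sums_of_two_squares L E = {a [^]\<^bsub>L\<^esub> (2::nat) \<oplus>\<^bsub>L\<^esub> b [^]\<^bsub>L\<^esub> (2::nat) | a b. a \<in> E \<and> b \<in> E}"

lemma pyth_tower_eq: "pyth_tower L F = rad_tower L (sums_of_two_squares L) F"
proof (intro ext iffI)
  show "rad_tower L (sums_of_two_squares L) F E" if "pyth_tower L F E" for E
    using that by induction (auto simp: sums_of_two_squares_def intro: rad_tower.intros)
  show "pyth_tower L F E" if "rad_tower L (sums_of_two_squares L) F E" for E
    using that by induction (auto simp: sums_of_two_squares_def intro: pyth_tower.intros)
qed

lemma quad_tower_eq: "quad_tower L F = rad_tower L (\<lambda>E. E) F"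
proof (intro ext iffI)
  show "rad_tower L (\<lambda>E. E) F E" if "quad_tower L F E" for E
    using that by induction (auto intro: rad_tower.intros)
  show "quad_tower L F E" if "rad_tower L (\<lambda>E. E) F E" for E
    using that by induction (auto intro: quad_tower.intros)
qed

text \<open>Membership in \<open>rad A\<close> is witnessed by two elements of \<open>A\<close>,
  valid in every set that contains them. So an admissible radicand over the union of all towers is
  already admissible at one stage. Sums of two squares take two witnesses; for arbitrary radicands
  the element itself serves as both.\<close>

locale rad_closure = field L + subfield F L for L (structure) and F +
  fixes rad :: "'a set \<Rightarrow> 'a set"
  assumes rad_finitary: "c \<in> rad A \<Longrightarrow> \<exists>a\<in>A. \<exists>b\<in>A. \<forall>B. a \<in> B \<longrightarrow> b \<in> B \<longrightarrow> c \<in> rad B"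
    and rad_carrier: "A \<subseteq> carrier L \<Longrightarrow> rad A \<subseteq> carrier L"
begin

lemma rad_mono: "A \<subseteq> B \<Longrightarrow> rad A \<subseteq> rad B"
  using rad_finitary by blast

definition closure :: "'a set" where
  "closure = \<Union> {E. rad_tower L rad F E}"

lemma rad_tower_subfield: "rad_tower L rad F E \<Longrightarrow> subfield E L \<and> F \<subseteq> E"
proof (induction rule: rad_tower.induct)
  case base
  show ?case using subfield_axioms by simp
next
  case (step E x)
  then have "insert x E \<subseteq> carrier L"
    using subfieldE(3) by auto
  then show ?case
    using step generate_field_is_subfield[of "insert x E"] generate_field.incl[of _ "insert x E" L] by blast
qed

text \<open>The tower of \<open>E\<^sub>2\<close> is rebuilt on top of \<open>E\<^sub>1\<close> by
  adjoining its square roots one at a time. A root that is already present is skipped, since every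
  step of a tower is proper.\<close>

lemma rad_tower_directed:
  assumes "rad_tower L rad F E\<^sub>2" "rad_tower L rad F E\<^sub>1"
  shows "\<exists>E. rad_tower L rad F E \<and> E\<^sub>1 \<subseteq> E \<and> E\<^sub>2 \<subseteq> E"
  using assms(1)
proof (induction rule: rad_tower.induct)
  case base
  then show ?case using assms(2) rad_tower_subfield by blast
next
  case (step E\<^sub>2 x)
  then obtain E where E: "rad_tower L rad F E" "E\<^sub>1 \<subseteq> E" "E\<^sub>2 \<subseteq> E"
    by blast
  have "insert x E\<^sub>2 \<subseteq> carrier L"
    using step.hyps(2) subfieldE(3) rad_tower_subfield[OF step.hyps(1)] by auto
  have "\<exists>E'. rad_tower L rad F E' \<and> E \<subseteq> E' \<and> x \<in> E'"
  proof (cases "x \<in> E")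
    case False
    have "x [^] (2::nat) \<in> rad E"
      using step.hyps(4) rad_mono[OF E(3)] by blast
    then have "rad_tower L rad F (generate_field L (insert x E))"
      by (rule rad_tower.step[OF E(1) step.hyps(2) False])
    moreover have "insert x E \<subseteq> generate_field L (insert x E)"
      by (intro subsetI generate_field.incl)
    ultimately show ?thesis
      by (intro exI[of _ "generate_field L (insert x E)"]) simp
  next
    case True
    then show ?thesis using E(1) by (intro exI[of _ E]) simp
  qed
  then obtain E' where E': "rad_tower L rad F E'" "E \<subseteq> E'" "x \<in> E'"
    by blast
  then have "generate_field L (insert x E\<^sub>2) \<subseteq> E'"
    using E(3) rad_tower_subfield[OF E'(1)] \<open>insert x E\<^sub>2 \<subseteq> carrier L\<close>
    by (intro generate_field_min_subfield1) auto
  then show ?case using E(2) E'(1,2) by (intro exI[of _ E']) simp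
qed

lemma closure_common_tower:
  assumes "x \<in> closure" "y \<in> closure"
  shows "\<exists>E. rad_tower L rad F E \<and> x \<in> E \<and> y \<in> E \<and> E \<subseteq> closure"
  using assms rad_tower_directed unfolding closure_def by blast

lemma closure_incl: "F \<subseteq> closure"
  unfolding closure_def using rad_tower.base by blast

lemma closure_subfield: "subfield closure L"
proof (rule subfieldI')
  show "subring closure L"
  proof (rule subringI)
    show "closure \<subseteq> carrier L"
      using subfieldE(3) rad_tower_subfield by (auto simp: closure_def)
    show "\<one> \<in> closure"
      using closure_incl subringE(3)[OF subfieldE(1)[OF subfield_axioms]] by blast
    show "\<ominus> x \<in> closure" if x: "x \<in> closure" for x
    proof -
      obtain E where E: "rad_tower L rad F E" "x \<in> E" "E \<subseteq> closure"
        using x unfolding closure_def by blast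
      then show ?thesis
        using rad_tower_subfield[OF E(1)] subringE(5)[OF subfieldE(1), of E L x] by auto
    qed
    fix x y assume xy: "x \<in> closure" "y \<in> closure"
    then obtain E where E: "rad_tower L rad F E" "x \<in> E" "y \<in> E" "E \<subseteq> closure"
      using closure_common_tower by blast
    then have "subring E L"
      using rad_tower_subfield[OF E(1)] subfieldE(1) by blast
    then show "x \<otimes> y \<in> closure" "x \<oplus> y \<in> closure"
      using E(2-4) subringE(6,7)[of E L] by auto
  qed
  fix k assume k: "k \<in> closure - {\<zero>}"
  then obtain E where E: "rad_tower L rad F E" "k \<in> E" "E \<subseteq> closure"
    unfolding closure_def by blast
  then show "inv k \<in> closure"
    using subfield_m_inv(1)[of E k] rad_tower_subfield[OF E(1)] k by auto
qed

lemma closure_rad_closed: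
  assumes x: "x \<in> carrier L" "x [^] (2::nat) \<in> rad closure"
  shows "x \<in> closure"
proof -
  obtain a b where ab: "a \<in> closure" "b \<in> closure" "\<And>B. a \<in> B \<Longrightarrow> b \<in> B \<Longrightarrow> x [^] (2::nat) \<in> rad B"
    using rad_finitary[OF x(2)] by blast
  obtain E where E: "rad_tower L rad F E" "a \<in> E" "b \<in> E" "E \<subseteq> closure"
    using closure_common_tower[OF ab(1,2)] by blast
  show ?thesis
  proof (cases "x \<in> E")
    case False
    then have "rad_tower L rad F (generate_field L (insert x E))"
      using E ab(3) x(1) by (intro rad_tower.step) auto
    then show ?thesis
      unfolding closure_def using generate_field.incl[of x "insert x E" L] by blast
  qed (use E in blast)
qed

text \<open>An induction principle for the closure. The condition on square roots speaks of elements
  of the closure because the set \<open>Q\<close> of the application consists of such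
  elements.\<close>

lemma closure_subset:
  assumes Q: "subfield Q L" "F \<subseteq> Q"
    and closed: "\<And>x. x \<in> closure \<Longrightarrow> x [^] (2::nat) \<in> rad Q \<Longrightarrow> x \<in> Q"
  shows "closure \<subseteq> Q"
proof -
  have "E \<subseteq> Q" if "rad_tower L rad F E" for E
    using that
  proof (induction rule: rad_tower.induct)
    case base
    show ?case by (rule Q)
  next
    case (step E x)
    have "x \<in> generate_field L (insert x E)"
      by (rule generate_field.incl) simp
    then have "x \<in> closure"
      unfolding closure_def using rad_tower.step[OF step(1-4)] by blast
    then have "x \<in> Q"
      using closed step rad_mono by blast
    then show ?case
      using step Q(1) subsetD[OF subfieldE(3)[OF Q(1)]] by (intro generate_field_min_subfield1) auto
  qed
  then show ?thesis unfolding closure_def by blast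
qed

text \<open>The elements whose conjugate stays in the image form a field \<open>Q\<close>. If the
  square of \<open>x\<close> is a radicand over \<open>Q\<close>, its conjugate is the image of some
  \<open>u\<close> in \<open>rad closure\<close>. A square root \<open>z\<close> of \<open>u\<close>
  lies in the closure, and the conjugate of \<open>x\<close> is \<open>g z\<close> up to sign, so
  \<open>x\<close> belongs to \<open>Q\<close>.\<close>

theorem closure_endo_stable:
  fixes g :: "'a \<Rightarrow> 'k::field"
  assumes sqrt: "\<And>u. u \<in> carrier L \<Longrightarrow> \<exists>z\<in>carrier L. z [^] (2::nat) = u"
    and g: "g \<in> ring_hom (L\<lparr>carrier := closure\<rparr>) ring_of_type_algebra"
    and \<tau>: "ring_endo \<tau>" "\<And>x. x \<in> F \<Longrightarrow> \<tau> (g x) = g x"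
    and rad: "\<And>A c. A \<subseteq> closure \<Longrightarrow> (\<And>a. a \<in> A \<Longrightarrow> \<tau> (g a) \<in> g ` closure) \<Longrightarrow> c \<in> rad A
      \<Longrightarrow> \<exists>u. u \<in> rad closure \<and> u \<in> closure \<and> c \<in> closure \<and> g u = \<tau> (g c)"
  shows "\<tau> ` g ` closure \<subseteq> g ` closure"
proof -
  let ?C = "L\<lparr>carrier := closure\<rparr>"
  interpret C: field ?C
    using closure_subfield subfield_iff(2) by blast
  have C_sub: "subring closure L"
    using closure_subfield subfieldE(1) by blast
  have g_add: "g (x \<oplus> y) = g x + g y" and g_mult: "g (x \<otimes> y) = g x * g y"
    if "x \<in> closure" "y \<in> closure" for x y
    using C.type_hom_add[OF g] C.type_hom_mult[OF g] that by auto
  have g_minus: "g (\<ominus> x) = - g x" if "x \<in> closure" for x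
    using g_add[of x "\<ominus> x"] that subringE(1,5)[OF C_sub] C.type_hom_zero[OF g]
    by (simp add: r_neg subsetD add_eq_0_iff)
  have g_inv: "g (inv x) = inverse (g x)" if "x \<in> closure" "x \<noteq> \<zero>" for x
    using g_mult[of x "inv x"] that subfield_m_inv[OF closure_subfield, of x] C.type_hom_one[OF g]
    by (simp add: inverse_unique)
  have g_sq: "g (x [^] (2::nat)) = (g x)\<^sup>2" if "x \<in> closure" for x
    using g_mult[OF that that] that subringE(1)[OF C_sub] by (simp add: numeral_2_eq_2 subsetD)
  define Q where "Q = {x \<in> closure. \<tau> (g x) \<in> g ` closure}"
  have img: "is_subfield (g ` closure)"
    using C.type_hom_image_subfield[OF g] by simp
  have "subfield Q L"
  proof (rule subfieldI', rule subringI)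
    show "Q \<subseteq> carrier L"
      using subringE(1)[OF C_sub] by (auto simp: Q_def)
    show "\<one> \<in> Q"
      using subringE(3)[OF C_sub] C.type_hom_one[OF g] is_subfieldD(1)[OF img]
      by (simp add: Q_def ring_endoD[OF \<tau>(1)])
    show "\<ominus> x \<in> Q" if "x \<in> Q" for x
      using that subringE(5)[OF C_sub] is_subfieldD(6)[OF img]
      by (simp add: Q_def g_minus ring_endoD[OF \<tau>(1)])
    show "x \<otimes> y \<in> Q" "x \<oplus> y \<in> Q" if "x \<in> Q" "y \<in> Q" for x y
      using that subringE(6,7)[OF C_sub] is_subfieldD(4,7)[OF img]
      by (simp_all add: Q_def g_mult g_add ring_endoD[OF \<tau>(1)])
    show "inv x \<in> Q" if "x \<in> Q - {\<zero>}" for x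
      using that subfield_m_inv(1)[OF closure_subfield, of x] is_subfieldD(5)[OF img]
      by (simp add: Q_def g_inv ring_endo_inverse[OF \<tau>(1)])
  qed
  moreover have "F \<subseteq> Q"
    using closure_incl \<tau>(2) by (auto simp: Q_def)
  moreover have "x \<in> Q" if x: "x \<in> closure" "x [^] (2::nat) \<in> rad Q" for x
  proof -
    obtain u where u: "u \<in> rad closure" "u \<in> closure" "g u = \<tau> (g (x [^] (2::nat)))"
    proof -
      have "\<exists>u. u \<in> rad closure \<and> u \<in> closure \<and> x [^] (2::nat) \<in> closure \<and> g u = \<tau> (g (x [^] (2::nat)))"
        by (rule rad[OF _ _ x(2)]) (auto simp: Q_def)
      then show ?thesis using that by blast
    qed
    obtain z where z: "z \<in> carrier L" "z [^] (2::nat) = u"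
      using sqrt u(2) subringE(1)[OF C_sub] by blast
    then have "z \<in> closure"
      using closure_rad_closed u(1) by blast
    have "(g z)\<^sup>2 = (\<tau> (g x))\<^sup>2"
      using u(3) z(2) g_sq[OF x(1)] g_sq[OF \<open>z \<in> closure\<close>] by (simp add: ring_endoD[OF \<tau>(1)])
    then have "\<tau> (g x) = g z \<or> \<tau> (g x) = - g z"
      by (auto simp: power2_eq_iff)
    then have "\<tau> (g x) \<in> g ` closure"
      using \<open>z \<in> closure\<close> is_subfieldD(6)[OF img, of "g z"] by auto
    then show ?thesis
      using x(1) by (simp add: Q_def)
  qed
  ultimately have "closure \<subseteq> Q"
    by (rule closure_subset)
  then show ?thesis
    by (auto simp: Q_def)
qed

end

text \<open>\<open>gen\<close> amounts to \<open>R\<close> being algebraic over the field generated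
  by the domain of \<open>G\<^sub>0\<close>; it is phrased so that it can be verified along a tower
  of fields, one storey at a time.\<close>

lemma (in field) exists_embedding_alg_closed:
  fixes G\<^sub>0 :: "('a \<times> 'k::alg_closed_field) set"
  assumes G0: "partial_iso R G\<^sub>0"
    and gen: "\<And>D. subfield D R \<Longrightarrow> fst ` G\<^sub>0 \<subseteq> D \<Longrightarrow>
      (\<And>z. z \<in> carrier R \<Longrightarrow> (algebraic over D) z \<Longrightarrow> z \<in> D) \<Longrightarrow> carrier R \<subseteq> D"
  shows "\<exists>\<iota>. \<iota> \<in> ring_hom R (ring_of_type_algebra :: 'k ring) \<and> inj_on \<iota> (carrier R) \<and>
    (\<forall>(a, b) \<in> G\<^sub>0. \<iota> a = b)"
proof -
  obtain G where G: "partial_iso R G" "G\<^sub>0 \<subseteq> G" "subfield (fst ` G) R"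
    "\<forall>z\<in>carrier R. (algebraic over (fst ` G)) z \<longrightarrow> z \<in> fst ` G"
    using exists_alg_closed_partial_iso[OF G0] by blast
  note D = partial_isoD[OF G(1)]
  have dom: "carrier R \<subseteq> fst ` G"
  proof (rule gen[OF G(3)])
    show "fst ` G\<^sub>0 \<subseteq> fst ` G"
      using G(2) by (rule image_mono)
  qed (use G(4) in blast)
  define \<iota> where "\<iota> x = (THE y. (x, y) \<in> G)" for x
  have \<iota>I: "\<iota> x = y" if "(x, y) \<in> G" for x y
    unfolding \<iota>_def by (rule the_equality) (use that D(7) in auto)
  have \<iota>: "(x, \<iota> x) \<in> G" if x: "x \<in> carrier R" for x
  proof -
    obtain y where "(x, y) \<in> G" using dom x by auto
    then show ?thesis using \<iota>I by auto
  qed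
  have "\<iota> (x \<otimes> y) = \<iota> x * \<iota> y" "\<iota> (x \<oplus> y) = \<iota> x + \<iota> y" if xy: "x \<in> carrier R" "y \<in> carrier R" for x y
  proof -
    show "\<iota> (x \<otimes> y) = \<iota> x * \<iota> y"
      by (intro \<iota>I D(5) \<iota> xy)
    have "(x \<ominus> (\<zero> \<ominus> y), \<iota> x - (0 - \<iota> y)) \<in> G"
      by (intro D(3,4) \<iota> xy)
    then show "\<iota> (x \<oplus> y) = \<iota> x + \<iota> y"
      using xy by (intro \<iota>I) (simp add: minus_eq)
  qed
  then have "\<iota> \<in> ring_hom R ring_of_type_algebra"
    using \<iota>I[OF D(2)] by (simp add: ring_hom_type_algebra_iff)
  moreover have "inj_on \<iota> (carrier R)"
    using D(7)[OF \<iota> \<iota>] by (auto intro: inj_onI)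
  moreover have "\<forall>(a, b) \<in> G\<^sub>0. \<iota> a = b"
    using \<iota>I G(2) by auto
  ultimately show ?thesis
    by blast
qed

text \<open>One storey of such a tower: a relatively algebraically closed \<open>D\<close> that
  contains the image of \<open>k\<close> absorbs the images of elements algebraic over
  \<open>k\<close>.\<close>

lemma subfield_algebraic_hom:
  assumes L: "field L" and E: "subfield E L" and k: "subfield k (L\<lparr>carrier := E\<rparr>)"
    and K: "field K" and h: "h \<in> ring_hom (L\<lparr>carrier := E\<rparr>) K"
    and x: "x \<in> E" "((ring.algebraic (L\<lparr>carrier := E\<rparr>)) over k) x"
    and D: "h ` k \<subseteq> D" "\<And>z. z \<in> carrier K \<Longrightarrow> ((ring.algebraic K) over D) z \<Longrightarrow> z \<in> D"
  shows "h x \<in> D"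
proof -
  interpret L: field L by fact
  interpret K: field K by fact
  have E': "field (L\<lparr>carrier := E\<rparr>)"
    by (rule L.subfield_iff(2)[OF E])
  have "((ring.algebraic K) over (h ` k)) (h x)"
    by (rule algebraic_hom[OF h E' K k _ x(2)]) (simp add: x(1))
  then have "((ring.algebraic K) over D) (h x)"
    using K.transcendental_mono[OF D(1)] by (auto simp: over_def)
  moreover have "h x \<in> carrier K"
    using ring_hom_closed[OF h] x(1) by simp
  ultimately show ?thesis using D(2) by blast
qed

lemma ring_hom_image_subfield:
  assumes "field R" "field S" "h \<in> ring_hom R S"
  shows "subfield (h ` carrier R) S"
proof -
  interpret R: field R by fact
  interpret S: field S by fact
  interpret h: ring_hom_ring R S h
    by (rule ring_hom_ringI2[OF R.ring_axioms S.ring_axioms assms(3)])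
  show ?thesis
    by (rule h.img_is_subfield(2)[OF R.carrier_is_subfield S.one_not_zero])
qed

section \<open>Finite extensions of the closures\<close>

lemma ring_endo_to_ac:
  fixes r :: rat
  assumes "ring_endo \<tau>"
  shows "\<tau> (to_ac r) = to_ac r"
proof -
  obtain a b :: int where "to_ac r = of_int a / of_int b"
    by (rule to_ac_rat_eq_quotient)
  then show ?thesis
    by (simp add: divide_inverse ring_endoD[OF assms] ring_endo_inverse[OF assms] ring_endo_of_int[OF assms])
qed

text \<open>The isomorphism of prime fields from which the embedding of \<open>K\<close> is
  extended.\<close>

lemma partial_iso_rat:
  fixes q :: "rat \<Rightarrow> 'a"
  assumes K: "field K" and q: "q \<in> ring_hom ring_of_type_algebra K"
  shows "partial_iso K (range (\<lambda>r. (q r, to_ac r)))"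
proof -
  interpret field K by fact
  have carr: "q r \<in> carrier K" for r
    using ring_hom_closed[OF q] by (simp add: ring_of_type_algebra_def)
  have mult: "q (r * s) = q r \<otimes>\<^bsub>K\<^esub> q s" and add: "q (r + s) = q r \<oplus>\<^bsub>K\<^esub> q s" for r s
    using ring_hom_mult[OF q, of r s] ring_hom_add[OF q, of r s] by (simp_all add: ring_of_type_algebra_def)
  have one: "q 1 = \<one>\<^bsub>K\<^esub>"
    using ring_hom_one[OF q] by (simp add: ring_of_type_algebra_def)
  have diff: "q (r - s) = q r \<ominus>\<^bsub>K\<^esub> q s" for r s
  proof -
    have "q r = q (r - s) \<oplus>\<^bsub>K\<^esub> q s"
      using add[of "r - s" s] by simp
    then show ?thesis
      using carr[of "r - s"] carr[of s] by (simp add: minus_eq a_assoc r_neg)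
  qed
  have zero: "q r = \<zero>\<^bsub>K\<^esub> \<longleftrightarrow> r = 0" for r
  proof
    assume "q r = \<zero>\<^bsub>K\<^esub>"
    then show "r = 0"
      using mult[of r "inverse r"] one carr by (cases "r = 0") auto
  next
    assume "r = 0"
    then show "q r = \<zero>\<^bsub>K\<^esub>"
      using diff[of 0 0] carr[of 0] by (simp add: minus_eq r_neg)
  qed
  show ?thesis
    unfolding partial_iso_def
  proof (intro conjI allI impI)
    show "range (\<lambda>r. (q r, to_ac r)) \<subseteq> carrier K \<times> UNIV"
      using carr by auto
    show "(\<one>\<^bsub>K\<^esub>, 1) \<in> range (\<lambda>r. (q r, to_ac r))"
      using one by (intro range_eqI[of _ _ 1]) simp
    show "a = \<zero>\<^bsub>K\<^esub> \<longleftrightarrow> b = 0" if ab: "(a, b) \<in> range (\<lambda>r. (q r, to_ac r))" for a b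
    proof -
      obtain r where "a = q r" "b = to_ac r"
        using ab by blast
      then show ?thesis by (simp add: zero)
    qed
    fix a b c d
    assume "(a, b) \<in> range (\<lambda>r. (q r, to_ac r))" "(c, d) \<in> range (\<lambda>r. (q r, to_ac r))"
    then obtain r s where rs: "a = q r" "b = to_ac r" "c = q s" "d = to_ac s"
      by blast
    have "(q (r - s), to_ac (r - s)) \<in> range (\<lambda>r. (q r, to_ac r))"
      and "(q (r * s), to_ac (r * s)) \<in> range (\<lambda>r. (q r, to_ac r))"
      by (rule rangeI)+
    then show "(a \<ominus>\<^bsub>K\<^esub> c, b - d) \<in> range (\<lambda>r. (q r, to_ac r))"
      and "(a \<otimes>\<^bsub>K\<^esub> c, b * d) \<in> range (\<lambda>r. (q r, to_ac r))"
      by (simp_all only: rs diff mult to_ac_diff to_ac_mult)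
  qed
qed

text \<open>As \<open>K\<close> lives in an arbitrary type, everything is moved to
  \<open>rat alg_closure\<close>: \<iota> embeds \<open>K\<close>, and its composition
  \<open>g\<close> with \<open>h\<close> carries the closure along. The hypothesis
  \<open>rad\<close> says that conjugates of radicands are again images of radicands; it is checked
  separately for each closure.\<close>

theorem (in rad_closure) finite_extension_nonsquare:
  fixes K :: "'c ring"
  assumes L: "algebraic_closure L F" and nf: "number_field (L\<lparr>carrier := F\<rparr>)"
    and rad: "\<And>g \<tau> A c. (g :: 'a \<Rightarrow> rat alg_closure) \<in> ring_hom (L\<lparr>carrier := closure\<rparr>) ring_of_type_algebra
      \<Longrightarrow> ring_endo \<tau> \<Longrightarrow> A \<subseteq> closure \<Longrightarrow> (\<And>a. a \<in> A \<Longrightarrow> \<tau> (g a) \<in> g ` closure) \<Longrightarrow> c \<in> rad A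
      \<Longrightarrow> \<exists>u. u \<in> rad closure \<and> u \<in> closure \<and> c \<in> closure \<and> g u = \<tau> (g c)"
    and fin: "finite_field_extension (L\<lparr>carrier := closure\<rparr>) K h"
    and proper: "h ` closure \<noteq> carrier K"
  shows "\<exists>x\<in>carrier K. \<forall>y\<in>carrier K. y [^]\<^bsub>K\<^esub> (2::nat) \<noteq> \<one>\<^bsub>K\<^esub> \<oplus>\<^bsub>K\<^esub> x [^]\<^bsub>K\<^esub> (2::nat)"
proof -
  let ?Q = "ring_of_type_algebra :: rat ring"
  let ?F = "L\<lparr>carrier := F\<rparr>" and ?C = "L\<lparr>carrier := closure\<rparr>"
  interpret AC: algebraic_closure L F by fact
  have "field K" and h: "h \<in> ring_hom ?C K" and dimK: "ring.finite_dimension K (h ` closure) (carrier K)"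
    using fin by (auto simp: finite_field_extension_def field_extension_def)
  interpret K: field K by fact
  interpret C: field ?C
    using subfield_iff(2)[OF closure_subfield] .
  interpret F: field ?F
    using subfield_iff(2)[OF subfield_axioms] .
  interpret Q: field ?Q by (rule field_from_type_algebra)
  obtain q where q: "q \<in> ring_hom ?Q ?F" and dimF: "F.finite_dimension (q ` carrier ?Q) F"
    using nf by (auto simp: number_field_def finite_field_extension_def field_extension_def)
  have UNIV: "carrier ?Q = UNIV" by (simp add: ring_of_type_algebra_def)
  have hF: "h \<in> ring_hom ?F K"
  proof (rule ring_hom_memI)
    fix x y assume "x \<in> carrier ?F" "y \<in> carrier ?F"
    then have xy: "x \<in> carrier ?C" "y \<in> carrier ?C"
      using closure_incl by auto
    show "h x \<in> carrier K"
      using ring_hom_closed[OF h xy(1)] .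
    show "h (x \<otimes>\<^bsub>?F\<^esub> y) = h x \<otimes>\<^bsub>K\<^esub> h y" "h (x \<oplus>\<^bsub>?F\<^esub> y) = h x \<oplus>\<^bsub>K\<^esub> h y"
      using ring_hom_mult[OF h xy] ring_hom_add[OF h xy] by simp_all
  next
    show "h \<one>\<^bsub>?F\<^esub> = \<one>\<^bsub>K\<^esub>"
      using ring_hom_one[OF h] by simp
  qed
  have qF: "subfield (range q) ?F"
    using ring_hom_image_subfield[OF Q.field_axioms F.field_axioms q] UNIV by simp
  have FC: "subfield F ?C"
    using C.subfield_iff(1)[of F] F.field_axioms closure_incl by simp
  have hC: "subfield (h ` closure) K"
    using ring_hom_image_subfield[OF C.field_axioms K.field_axioms h] by simp
  define G\<^sub>0 where "G\<^sub>0 = range (\<lambda>r. ((h \<circ> q) r, to_ac r))"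
  have G0: "partial_iso K G\<^sub>0"
    unfolding G\<^sub>0_def by (rule partial_iso_rat[OF K.field_axioms ring_hom_trans[OF q hF]])
  \<comment> \<open>Three storeys: \<open>F\<close> is algebraic over the rationals, the closure
    over \<open>F\<close>, and \<open>K\<close> over the closure. \<open>D\<close> absorbs one after
    the other.\<close>
  have gen: "carrier K \<subseteq> D"
    if D: "subfield D K" "fst ` G\<^sub>0 \<subseteq> D" "\<And>z. z \<in> carrier K \<Longrightarrow> (K.algebraic over D) z \<Longrightarrow> z \<in> D" for D
  proof -
    have "h x \<in> D" if "x \<in> F" for x
    proof (rule subfield_algebraic_hom[OF field_axioms subfield_axioms qF K.field_axioms hF that _ _ D(3)])
      show "(F.algebraic over (range q)) x"
        using F.finite_dimension_imp_algebraic[OF qF F.carrier_is_subring] dimF that UNIV by simp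
      show "h ` range q \<subseteq> D"
        using D(2) by (auto simp: G\<^sub>0_def image_image)
    qed
    then have hF_D: "h ` F \<subseteq> D" by blast
    have "h x \<in> D" if "x \<in> closure" for x
    proof (rule subfield_algebraic_hom[OF field_axioms closure_subfield FC K.field_axioms h that _ hF_D D(3)])
      have "(algebraic over F) x"
        using AC.algebraic_extension that subfieldE(3)[OF closure_subfield] by blast
      then show "(C.algebraic over F) x"
        by (simp add: over_def transcendental_consistent[OF subfieldE(1)[OF closure_subfield]])
    qed
    then have hC_D: "h ` closure \<subseteq> D" by blast
    show "carrier K \<subseteq> D"
    proof
      fix x assume x: "x \<in> carrier K"
      have "(K.algebraic over (h ` closure)) x"
        using K.finite_dimension_imp_algebraic[OF hC K.carrier_is_subring dimK x] .
      then have "(K.algebraic over D) x"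
        using K.transcendental_mono[OF hC_D] by (auto simp: over_def)
      then show "x \<in> D" using D(3) x by blast
    qed
  qed
  obtain \<iota> :: "'c \<Rightarrow> rat alg_closure" where
    \<iota>: "\<iota> \<in> ring_hom K ring_of_type_algebra" "inj_on \<iota> (carrier K)" "\<forall>(a, b) \<in> G\<^sub>0. \<iota> a = b"
    using K.exists_embedding_alg_closed[OF G0 gen] by blast
  define g where "g = \<iota> \<circ> h"
  have g: "g \<in> ring_hom ?C ring_of_type_algebra"
    unfolding g_def by (rule ring_hom_trans[OF h \<iota>(1)])
  have gq: "g (q r) = to_ac r" for r
    using \<iota>(3) by (auto simp: G\<^sub>0_def g_def)
  obtain U\<^sub>1 where U1: "finite U\<^sub>1" "U\<^sub>1 \<subseteq> F"
    "\<forall>S. range q \<subseteq> S \<longrightarrow> U\<^sub>1 \<subseteq> S \<longrightarrow> (\<forall>x\<in>S. \<forall>y\<in>S. x \<oplus> y \<in> S \<and> x \<otimes> y \<in> S) \<longrightarrow> F \<subseteq> S"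
    using F.finite_dimension_generators[OF qF dimF[unfolded UNIV]] by auto
  obtain U\<^sub>2 where U2: "finite U\<^sub>2" "U\<^sub>2 \<subseteq> carrier K"
    "\<forall>S. h ` closure \<subseteq> S \<longrightarrow> U\<^sub>2 \<subseteq> S \<longrightarrow> (\<forall>x\<in>S. \<forall>y\<in>S. x \<oplus>\<^bsub>K\<^esub> y \<in> S \<and> x \<otimes>\<^bsub>K\<^esub> y \<in> S)
      \<longrightarrow> carrier K \<subseteq> S"
    using K.finite_dimension_generators[OF hC dimK] by blast
  have hC_carrier: "h ` closure \<subseteq> carrier K"
    using ring_hom_closed[OF h] by auto
  have "\<exists>x\<in>\<iota> ` carrier K. \<forall>y\<in>\<iota> ` carrier K. y\<^sup>2 \<noteq> 1 + x\<^sup>2"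
  proof (rule nonsquare_in_finite_extension_of_stable[where P = "g ` closure" and \<Phi> = "g ` U\<^sub>1" and \<Omega> = "\<iota> ` U\<^sub>2"])
    show "is_subfield (g ` closure)"
      using C.type_hom_image_subfield[OF g] by simp
    show "is_subfield (\<iota> ` carrier K)"
      using K.type_hom_image_subfield[OF \<iota>(1)] .
    show "g ` closure \<subseteq> \<iota> ` carrier K"
      using hC_carrier by (auto simp: g_def)
    show "\<iota> ` carrier K \<noteq> g ` closure"
      using inj_on_image_eq_iff[OF \<iota>(2) hC_carrier subset_refl] proper by (auto simp: g_def image_comp)
    show "finite (g ` U\<^sub>1)" "finite (\<iota> ` U\<^sub>2)"
      using U1(1) U2(1) by auto
    show "\<tau> ` g ` closure \<subseteq> g ` closure" if \<tau>: "ring_endo \<tau>" "\<And>x. x \<in> g ` U\<^sub>1 \<Longrightarrow> \<tau> x = x" for \<tau>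
    proof (rule closure_endo_stable[OF _ g \<tau>(1)])
      show "\<exists>z\<in>carrier L. z [^] (2::nat) = u" if "u \<in> carrier L" for u
        by (rule AC.exists_sqrt[OF that]) blast
      \<comment> \<open>\<tau> fixes the generators \<open>U\<^sub>1\<close> by assumption and the
        rationals automatically, hence all of \<open>F\<close>.\<close>
      have "F \<subseteq> {x \<in> F. \<tau> (g x) = g x}"
      proof (rule U1(3)[rule_format])
        show "range q \<subseteq> {x \<in> F. \<tau> (g x) = g x}"
          using ring_hom_closed[OF q] UNIV by (auto simp: gq ring_endo_to_ac[OF \<tau>(1)])
        show "U\<^sub>1 \<subseteq> {x \<in> F. \<tau> (g x) = g x}"
          using U1(2) \<tau>(2) by auto
        show "x \<oplus> y \<in> {x \<in> F. \<tau> (g x) = g x} \<and> x \<otimes> y \<in> {x \<in> F. \<tau> (g x) = g x}"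
          if "x \<in> {x \<in> F. \<tau> (g x) = g x}" "y \<in> {x \<in> F. \<tau> (g x) = g x}" for x y
        proof -
          have "x \<in> closure" "y \<in> closure" "x \<in> F" "y \<in> F"
            using that closure_incl by auto
          then show ?thesis
            using that C.type_hom_add[OF g, of x y] C.type_hom_mult[OF g, of x y]
              F.a_closed[of x y] F.m_closed[of x y]
            by (simp add: ring_endoD[OF \<tau>(1)])
        qed
      qed
      then show "\<tau> (g x) = g x" if "x \<in> F" for x
        using that by blast
    next
      show "\<exists>u. u \<in> rad closure \<and> u \<in> closure \<and> c \<in> closure \<and> g u = \<tau> (g c)"
        if A: "A \<subseteq> closure" "\<And>a. a \<in> A \<Longrightarrow> \<tau> (g a) \<in> g ` closure" "c \<in> rad A" for A c
        using rad[OF g \<tau>(1) A] .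
    qed
    show "\<iota> ` carrier K \<subseteq> A" if A: "is_subfield A" "g ` closure \<union> \<iota> ` U\<^sub>2 \<subseteq> A" for A
    proof -
      have "carrier K \<subseteq> {x \<in> carrier K. \<iota> x \<in> A}"
      proof (rule U2(3)[rule_format])
        show "h ` closure \<subseteq> {x \<in> carrier K. \<iota> x \<in> A}"
          using A(2) hC_carrier by (auto simp: g_def)
        show "U\<^sub>2 \<subseteq> {x \<in> carrier K. \<iota> x \<in> A}"
          using A(2) U2(2) by auto
        fix x y assume "x \<in> {x \<in> carrier K. \<iota> x \<in> A}" "y \<in> {x \<in> carrier K. \<iota> x \<in> A}"
        then show "x \<oplus>\<^bsub>K\<^esub> y \<in> {x \<in> carrier K. \<iota> x \<in> A} \<and> x \<otimes>\<^bsub>K\<^esub> y \<in> {x \<in> carrier K. \<iota> x \<in> A}"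
          using K.type_hom_add[OF \<iota>(1)] K.type_hom_mult[OF \<iota>(1)] is_subfieldD(4,7)[OF A(1)] by simp
      qed
      then show ?thesis by auto
    qed
    show "Polynomial.algebraic x" for x :: "rat alg_closure"
      by (rule algebraic_rat_alg_closure)
  qed
  then obtain x where x: "x \<in> carrier K" "\<forall>y\<in>carrier K. (\<iota> y)\<^sup>2 \<noteq> 1 + (\<iota> x)\<^sup>2"
    by auto
  have "y [^]\<^bsub>K\<^esub> (2::nat) \<noteq> \<one>\<^bsub>K\<^esub> \<oplus>\<^bsub>K\<^esub> x [^]\<^bsub>K\<^esub> (2::nat)" if y: "y \<in> carrier K" for y
  proof
    assume eq: "y [^]\<^bsub>K\<^esub> (2::nat) = \<one>\<^bsub>K\<^esub> \<oplus>\<^bsub>K\<^esub> x [^]\<^bsub>K\<^esub> (2::nat)"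
    have "(\<iota> y)\<^sup>2 = \<iota> (y [^]\<^bsub>K\<^esub> (2::nat))"
      using K.type_hom_power2[OF \<iota>(1) y] by simp
    also have "\<dots> = 1 + (\<iota> x)\<^sup>2"
      unfolding eq using x(1)
      by (simp add: K.type_hom_add[OF \<iota>(1)] K.type_hom_one[OF \<iota>(1)] K.type_hom_power2[OF \<iota>(1)])
    finally show False using x(2) y by blast
  qed
  then show ?thesis using x(1) by blast
qed

section \<open>The pythagorean and the quadratic closure\<close>

lemma pythagorean_sum_two_squares:
  assumes "pythagorean K" "x \<in> carrier K" "y \<in> carrier K"
  shows "\<exists>z\<in>carrier K. z [^]\<^bsub>K\<^esub> (2::nat) = x [^]\<^bsub>K\<^esub> (2::nat) \<oplus>\<^bsub>K\<^esub> y [^]\<^bsub>K\<^esub> (2::nat)"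
proof -
  interpret field K
    using assms(1) by (simp add: pythagorean_def)
  define f where "f i = (if i = 0 then x else y)" for i :: nat
  have "f \<in> {..<2} \<rightarrow> carrier K"
    using assms(2,3) by (auto simp: f_def)
  then obtain z where z: "z \<in> carrier K"
    "(\<Oplus>\<^bsub>K\<^esub>i\<in>{..<2}. f i [^]\<^bsub>K\<^esub> (2::nat)) = z [^]\<^bsub>K\<^esub> (2::nat)"
    using assms(1) unfolding pythagorean_def by blast
  have "{..<2} = {0, 1::nat}" by auto
  then have "(\<Oplus>\<^bsub>K\<^esub>i\<in>{..<2}. f i [^]\<^bsub>K\<^esub> (2::nat)) = x [^]\<^bsub>K\<^esub> (2::nat) \<oplus>\<^bsub>K\<^esub> y [^]\<^bsub>K\<^esub> (2::nat)"
    using assms(2,3) by (simp add: f_def)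
  then show ?thesis using z by auto
qed

lemma rad_closure_sums_of_two_squares:
  assumes "field L" "subfield F L"
  shows "rad_closure L F (sums_of_two_squares L)"
proof -
  interpret field L by fact
  interpret subfield F L by fact
  show ?thesis
  proof
    show "\<exists>a\<in>A. \<exists>b\<in>A. \<forall>B. a \<in> B \<longrightarrow> b \<in> B \<longrightarrow> c \<in> sums_of_two_squares L B"
      if "c \<in> sums_of_two_squares L A" for c A
      using that by (fastforce simp: sums_of_two_squares_def)
    show "sums_of_two_squares L A \<subseteq> carrier L" if "A \<subseteq> carrier L" for A
      using that by (auto simp: sums_of_two_squares_def)
  qed
qed

lemma rad_closure_id:
  assumes "field L" "subfield F L"
  shows "rad_closure L F (\<lambda>E. E)"
proof -
  interpret field L by fact
  interpret subfield F L by fact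
  show ?thesis by unfold_locales auto
qed

lemma hereditarily_non_pythagorean_closure:
  assumes L: "algebraic_closure L F" and nf: "number_field (L\<lparr>carrier := F\<rparr>)"
  shows "hereditarily_non_pythagorean TYPE('c) (pythagorean_closure L F)"
proof -
  interpret AC: algebraic_closure L F by fact
  interpret rad_closure L F "sums_of_two_squares L"
    by (rule rad_closure_sums_of_two_squares[OF AC.field_axioms AC.subfield_axioms])
  have eq: "pythagorean_closure L F = L\<lparr>carrier := closure\<rparr>"
    by (simp add: pythagorean_closure_def closure_def pyth_tower_eq)
  have C: "field (L\<lparr>carrier := closure\<rparr>)"
    using AC.subfield_iff(2)[OF closure_subfield] .
  have "\<not> pythagorean K"
    if fin: "finite_field_extension (L\<lparr>carrier := closure\<rparr>) K h"
      and proper: "proper_field_extension (L\<lparr>carrier := closure\<rparr>) K h" for K :: "'c ring" and h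
  proof
    assume K: "pythagorean K"
    interpret K: field K
      using K by (simp add: pythagorean_def)
    have "\<exists>x\<in>carrier K. \<forall>y\<in>carrier K. y [^]\<^bsub>K\<^esub> (2::nat) \<noteq> \<one>\<^bsub>K\<^esub> \<oplus>\<^bsub>K\<^esub> x [^]\<^bsub>K\<^esub> (2::nat)"
    proof (rule finite_extension_nonsquare[OF L nf _ fin])
      show "h ` closure \<noteq> carrier K"
        using proper by (simp add: proper_field_extension_def)
      fix g :: "'a \<Rightarrow> rat alg_closure" and \<tau> A c
      assume g: "g \<in> ring_hom (L\<lparr>carrier := closure\<rparr>) ring_of_type_algebra" and \<tau>: "ring_endo \<tau>"
        and A: "A \<subseteq> closure" "\<And>a. a \<in> A \<Longrightarrow> \<tau> (g a) \<in> g ` closure" and c: "c \<in> sums_of_two_squares L A"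
      interpret C: field "L\<lparr>carrier := closure\<rparr>" by (rule C)
      obtain a b where ab: "a \<in> A" "b \<in> A" and c_eq: "c = a [^]\<^bsub>L\<^esub> (2::nat) \<oplus>\<^bsub>L\<^esub> b [^]\<^bsub>L\<^esub> (2::nat)"
        using c by (auto simp: sums_of_two_squares_def)
      obtain u v where uv: "u \<in> closure" "v \<in> closure" "g u = \<tau> (g a)" "g v = \<tau> (g b)"
        using A(2)[OF ab(1)] A(2)[OF ab(2)] by (metis imageE)
      have sums: "x [^]\<^bsub>L\<^esub> (2::nat) \<oplus>\<^bsub>L\<^esub> y [^]\<^bsub>L\<^esub> (2::nat) \<in> closure \<and>
          g (x [^]\<^bsub>L\<^esub> (2::nat) \<oplus>\<^bsub>L\<^esub> y [^]\<^bsub>L\<^esub> (2::nat)) = (g x)\<^sup>2 + (g y)\<^sup>2"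
        if xy: "x \<in> closure" "y \<in> closure" for x y
      proof -
        have pow: "z [^]\<^bsub>L\<lparr>carrier := closure\<rparr>\<^esub> (2::nat) = z [^]\<^bsub>L\<^esub> (2::nat)" for z
          by (simp add: numeral_2_eq_2)
        show ?thesis
          using C.type_hom_power2[OF g, of x] C.type_hom_power2[OF g, of y]
            C.type_hom_add[OF g, of "x [^]\<^bsub>L\<^esub> (2::nat)" "y [^]\<^bsub>L\<^esub> (2::nat)"]
            C.nat_pow_closed[of x 2] C.nat_pow_closed[of y 2]
            C.a_closed[of "x [^]\<^bsub>L\<^esub> (2::nat)" "y [^]\<^bsub>L\<^esub> (2::nat)"] xy
          by (simp add: pow)
      qed
      have "a \<in> closure" "b \<in> closure"
        using ab A(1) by auto
      then have c_val: "c \<in> closure" "g c = (g a)\<^sup>2 + (g b)\<^sup>2"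
        using sums c_eq by auto
      \<comment> \<open>Conjugation takes a sum of two squares to the sum of the squares of the
        conjugates, and \<open>u\<close> and \<open>v\<close> realise these conjugates inside the
        closure.\<close>
      define w where "w = u [^]\<^bsub>L\<^esub> (2::nat) \<oplus>\<^bsub>L\<^esub> v [^]\<^bsub>L\<^esub> (2::nat)"
      have "w \<in> sums_of_two_squares L closure"
        using uv(1,2) by (auto simp: w_def sums_of_two_squares_def)
      moreover have "w \<in> closure" "g w = \<tau> (g c)"
        using sums[OF uv(1,2)] uv(3,4) c_val(2) by (simp_all add: w_def ring_endoD[OF \<tau>])
      ultimately show "\<exists>u. u \<in> sums_of_two_squares L closure \<and> u \<in> closure \<and> c \<in> closure \<and> g u = \<tau> (g c)"
        using c_val(1) by blast
    qed
    then show False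
      using pythagorean_sum_two_squares[OF K K.one_closed] by (metis K.nat_pow_one)
  qed
  then show ?thesis
    using C unfolding hereditarily_non_pythagorean_def eq by blast
qed

text \<open>Every element is an admissible radicand here, so the condition on conjugate radicands is
  just what is assumed about the elements of \<open>A\<close>.\<close>

lemma hereditarily_non_quadratically_closed_closure:
  assumes L: "algebraic_closure L F" and nf: "number_field (L\<lparr>carrier := F\<rparr>)"
  shows "hereditarily_non_quadratically_closed TYPE('c) (quadratic_closure L F)"
proof -
  interpret AC: algebraic_closure L F by fact
  interpret rad_closure L F "\<lambda>E. E"
    by (rule rad_closure_id[OF AC.field_axioms AC.subfield_axioms])
  have eq: "quadratic_closure L F = L\<lparr>carrier := closure\<rparr>"
    by (simp add: quadratic_closure_def closure_def quad_tower_eq)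
  have C: "field (L\<lparr>carrier := closure\<rparr>)"
    using AC.subfield_iff(2)[OF closure_subfield] .
  have "\<not> quadratically_closed K"
    if fin: "finite_field_extension (L\<lparr>carrier := closure\<rparr>) K h"
      and proper: "proper_field_extension (L\<lparr>carrier := closure\<rparr>) K h" for K :: "'c ring" and h
  proof
    assume K: "quadratically_closed K"
    interpret K: field K
      using K by (simp add: quadratically_closed_def)
    have "\<exists>x\<in>carrier K. \<forall>y\<in>carrier K. y [^]\<^bsub>K\<^esub> (2::nat) \<noteq> \<one>\<^bsub>K\<^esub> \<oplus>\<^bsub>K\<^esub> x [^]\<^bsub>K\<^esub> (2::nat)"
    proof (rule finite_extension_nonsquare[OF L nf _ fin])
      show "h ` closure \<noteq> carrier K"
        using proper by (simp add: proper_field_extension_def)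
      fix g :: "'a \<Rightarrow> rat alg_closure" and \<tau> A c
      assume A: "A \<subseteq> closure" "\<And>a. a \<in> A \<Longrightarrow> \<tau> (g a) \<in> g ` closure" and c: "c \<in> A"
      obtain u where "u \<in> closure" "g u = \<tau> (g c)"
        using A(2)[OF c] by (metis imageE)
      then show "\<exists>u. u \<in> closure \<and> u \<in> closure \<and> c \<in> closure \<and> g u = \<tau> (g c)"
        using A(1) c by blast
    qed
    then obtain x where x: "x \<in> carrier K"
      "\<forall>y\<in>carrier K. y [^]\<^bsub>K\<^esub> (2::nat) \<noteq> \<one>\<^bsub>K\<^esub> \<oplus>\<^bsub>K\<^esub> x [^]\<^bsub>K\<^esub> (2::nat)"
      by blast
    have "\<one>\<^bsub>K\<^esub> \<oplus>\<^bsub>K\<^esub> x [^]\<^bsub>K\<^esub> (2::nat) \<in> carrier K"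
      using x(1) by simp
    then obtain y where "y \<in> carrier K" "\<one>\<^bsub>K\<^esub> \<oplus>\<^bsub>K\<^esub> x [^]\<^bsub>K\<^esub> (2::nat) = y [^]\<^bsub>K\<^esub> (2::nat)"
      using K unfolding quadratically_closed_def by blast
    then show False
      using x(2) by auto
  qed
  then show ?thesis
    using C unfolding hereditarily_non_quadratically_closed_def eq by blast
qed

theorem corollary3p5:
  fixes L :: "('a, 'm) ring_scheme" and F :: "'a set"
  assumes "algebraic_closure L F"
    and "number_field (L \<lparr> carrier := F \<rparr>)"
  shows "hereditarily_non_pythagorean TYPE('c) (pythagorean_closure L F) \<and>
         hereditarily_non_quadratically_closed TYPE('c) (quadratic_closure L F)"
  using hereditarily_non_pythagorean_closure[OF assms]
    hereditarily_non_quadratically_closed_closure[OF assms] by blast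

end
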